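(* Let $c$ and $d$ be nonzero real numbers, let $a>-1$ be real, and let $0<j_1(a,c,d)<j_2(a,c,d)<\cdots$ be the positive zeros of $x\mapsto cJ_a(x)+dJ_{a+1}(x)$. Write $$\sigma = \frac{(2a+1)cd}{c^2+d^2}.$$ (i) If $a \ge \frac12$ and $c$ has the same sign as $d$, then for all $k \ge 1$ $$j_{k+2}(a,c,d) - j_{k+1}(a,c,d) < j_{k+1}(a,c,d) - j_k(a,c,d).$$ (ii) If $0<a<\frac12$ and $c$ has the same sign as $d$, then for all $k\ge 1$ $$\frac{\left(1+\frac{\sigma}{j_{k+2}(a,c,d)}\right)\left(1+\frac{\sigma}{j_k(a,c,d)}\right)}{\left(1+\frac{\sigma}{j_{k+1}(a,c,d)}\right)^2} > e^{\sigma\Delta^2 j_k(a,c,d) - \sigma^2\Delta^2 j_k^2(a,c,d)},$$ where $$\Delta^2 j_k(a,c,d) = \frac{1}{j_{k+2}(a,c,d)}+\frac{1}{j_k(a,c,d)}-\frac{2}{j_{k+1}(a,c,d)}, \qquad \Delta^2 j_k^2(a,c,d) = \frac{1}{j_{k+2}(a,c,d)^2}+\frac{1}{j_k(a,c,d)^2}-\frac{2}{j_{k+1}(a,c,d)^2}.$$ (iii) If $-\frac12<a\le 0$ and $c$ has the same sign as $d$, then for all $k\ge1$ $$\frac{\left(1+\frac{\sigma}{j_{k+2}(a,c,d)}\right)\left(1+\frac{\sigma}{j_k(a,c,d)}\right)}{\left(1+\frac{\sigma}{j_{k+1}(a,c,d)}\right)^2} < e^{\sigma\Delta^2 j_k(a,c,d)},$$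 with $\Delta^2 j_k(a,c,d)$ as in (ii). (iv) If $-1<a<-\frac12$, $d^2\ge c^2$ and $c$ has the opposite sign to $d$, then for all $k \ge 1$ $$\frac{(\sigma+j_{k+2}(a,c,d))(\sigma+j_k(a,c,d))}{(\sigma+j_{k+1}(a,c,d))^2} < e^{\frac1\sigma \delta^2 j_k(a,c,d)},$$ where $\delta^2 j_k(a,c,d) = j_{k+2}(a,c,d)-2j_{k+1}(a,c,d)+j_k(a,c,d)$.
   Context: $J_a$ denotes the Bessel function of the first kind of order $a$. For $a>-1$ and real $c,d$ not both zero, the function $cJ_a(x)+dJ_{a+1}(x)$ has infinitely many positive zeros, which are listed in increasing order as $j_k(a,c,d)$, $k\ge1$. *)

theory Defs
  imports "HOL-Analysis.Analysis"
begin

text \<open>The Bessel function of the first kind of real order \<open>a\<close>, given by its power series on the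
  positive half-line; \<open>powr\<close> makes the value meaningful for \<open>x > 0\<close> only. The entire function
  \<open>rGamma = 1 / Gamma\<close> gives the usual convention at the poles of \<open>Gamma\<close>.\<close>

definition Bessel_J :: "real \<Rightarrow> real \<Rightarrow> real" where
  "Bessel_J a x =
     (\<Sum>m. (-1) ^ m * rGamma (real m + a + 1) / fact m * (x / 2) powr (2 * real m + a))"

definition bessel_pos_zeros :: "real \<Rightarrow> real \<Rightarrow> real \<Rightarrow> real set" where
  "bessel_pos_zeros a c d = {x. 0 < x \<and> c * Bessel_J a x + d * Bessel_J (a + 1) x = 0}"

text \<open>Sequences are indexed from 1; the value \<open>j 0\<close> is irrelevant.\<close>

definition lists_increasingly :: "(nat \<Rightarrow> real) \<Rightarrow> real set \<Rightarrow> bool" where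
  "lists_increasingly j Z \<longleftrightarrow> strict_mono_on {1..} j \<and> j ` {1..} = Z"

definition diff2 :: "(nat \<Rightarrow> real) \<Rightarrow> nat \<Rightarrow> real" where
  "diff2 j k = j (k + 2) - 2 * j (k + 1) + j k"

definition recip_diff2 :: "(nat \<Rightarrow> real) \<Rightarrow> nat \<Rightarrow> real" where
  "recip_diff2 j k = 1 / j (k + 2) + 1 / j k - 2 / j (k + 1)"

definition recip_sq_diff2 :: "(nat \<Rightarrow> real) \<Rightarrow> nat \<Rightarrow> real" where
  "recip_sq_diff2 j k = 1 / (j (k + 2))\<^sup>2 + 1 / (j k)\<^sup>2 - 2 / (j (k + 1))\<^sup>2"

end

theory Submission
  imports Defs
begin

text \<open>After multiplication by \<open>\<surd>(x\<^sup>2 / (x + \<sigma>))\<close> the function \<open>c J\<^sub>a + d J\<^sub>a\<^sub>+\<^sub>1\<close> solves \<open>w'' = - G w\<close> with an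
  explicit rational \<open>G\<close>. Passing to a new variable \<open>t\<close> with \<open>dt = \<rho> dx\<close> turns this into an equation
  of the same kind with potential \<open>\<Phi> = (G + l\<^sup>2/4 - l'/2) / \<rho>\<^sup>2\<close>, \<open>l = \<rho>'/\<rho>\<close>. If \<open>\<Phi>\<close> is increasing,
  Sturm comparison of a solution with its reflection in a zero shows that the gaps between
  consecutive zeros, measured in \<open>t\<close>, decrease; if \<open>\<Phi>\<close> is decreasing, they increase.
  The four inequalities come from the densities \<open>1\<close>, \<open>(x + 2\<sigma>) / (x\<^sup>3 (x + \<sigma>))\<close>,
  \<open>1 / (x\<^sup>2 (x + \<sigma>))\<close> and \<open>x / (x + \<sigma>)\<close>. Only for the second one is \<open>\<Phi>\<close> not visibly monotone on the
  whole half-line, but there all zeros exceed \<open>2\<close>.\<close>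

section \<open>Sturm comparison and the Liouville transformation\<close>

text \<open>The Wronskian \<open>W = P Q' - P' Q\<close> has derivative
  \<open>(\<phi> - \<psi>) P Q\<close>, which is negative inside the interval, and
  \<open>W \<beta> = 0\<close>; hence \<open>W \<alpha> > 0\<close>. But
  \<open>W \<alpha> = - P' \<alpha> * Q \<alpha>\<close>, where neither factor
  \<open>P' \<alpha>\<close>, \<open>Q \<alpha>\<close> can be negative: \<open>P\<close> rises from
  its zero at \<open>\<alpha>\<close>, and \<open>Q\<close> is positive immediately to the
  right.\<close>

lemma sturm_no_common_arch:
  fixes P P' Q Q' \<phi> \<psi> :: "real \<Rightarrow> real"
  assumes "\<alpha> < \<beta>"
    and P: "\<And>s. s \<in> {\<alpha>..\<beta>} \<Longrightarrow> (P has_real_derivative P' s) (at s)"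
    and P': "\<And>s. s \<in> {\<alpha>..\<beta>} \<Longrightarrow> (P' has_real_derivative - \<phi> s * P s) (at s)"
    and Q: "\<And>s. s \<in> {\<alpha>..\<beta>} \<Longrightarrow> (Q has_real_derivative Q' s) (at s)"
    and Q': "\<And>s. s \<in> {\<alpha>..\<beta>} \<Longrightarrow> (Q' has_real_derivative - \<psi> s * Q s) (at s)"
    and less: "\<And>s. s \<in> {\<alpha><..<\<beta>} \<Longrightarrow> \<phi> s < \<psi> s"
    and Ppos: "\<And>s. s \<in> {\<alpha><..<\<beta>} \<Longrightarrow> P s > 0"
    and Qpos: "\<And>s. s \<in> {\<alpha><..<\<beta>} \<Longrightarrow> Q s > 0"
    and zero: "P \<alpha> = 0" "P \<beta> = 0" "Q \<beta> = 0"
  shows False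
proof -
  define W where "W s = P s * Q' s - P' s * Q s" for s
  have W: "(W has_real_derivative (\<phi> s - \<psi> s) * (P s * Q s)) (at s)" if "s \<in> {\<alpha>..\<beta>}" for s
    unfolding W_def
    by (rule derivative_eq_intros P[OF that] P'[OF that] Q[OF that] Q'[OF that] refl)+
      (simp add: algebra_simps)
  have "W \<beta> < W \<alpha>"
  proof (rule DERIV_neg_imp_decreasing_open[OF \<open>\<alpha> < \<beta>\<close>])
    show "\<exists>y. (W has_real_derivative y) (at s) \<and> y < 0" if "\<alpha> < s" "s < \<beta>" for s
      using W[of s] less[of s] Ppos[of s] Qpos[of s] that
      by (intro exI[of _ "(\<phi> s - \<psi> s) * (P s * Q s)"]) (auto intro!: mult_neg_pos)
    show "continuous_on {\<alpha>..\<beta>} W"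
      using W DERIV_isCont by (intro continuous_at_imp_continuous_on ballI) blast
  qed
  then have "P' \<alpha> * Q \<alpha> < 0"
    using zero by (simp add: W_def)
  moreover have "Q \<alpha> \<ge> 0"
  proof (rule ccontr)
    assume "\<not> Q \<alpha> \<ge> 0"
    then have "eventually (\<lambda>s. Q s < 0) (at_right \<alpha>)"
      using DERIV_isCont[OF Q[of \<alpha>]] \<open>\<alpha> < \<beta>\<close>
      by (intro order_tendstoD(2)[of Q "Q \<alpha>"]) (auto simp: isCont_def intro: tendsto_mono at_le)
    moreover have "eventually (\<lambda>s. s \<in> {\<alpha><..<\<beta>}) (at_right \<alpha>)"
      using \<open>\<alpha> < \<beta>\<close> by (rule eventually_at_right_real)
    ultimately have "eventually (\<lambda>s. False) (at_right \<alpha>)"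
      by eventually_elim (use Qpos in fastforce)
    then show False by simp
  qed
  moreover have "P' \<alpha> \<ge> 0"
  proof (rule ccontr)
    assume "\<not> P' \<alpha> \<ge> 0"
    then obtain e where e: "e > 0" "\<And>h. 0 < h \<Longrightarrow> h < e \<Longrightarrow> P (\<alpha> + h) < P \<alpha>"
      using DERIV_neg_dec_right[OF P[of \<alpha>]] \<open>\<alpha> < \<beta>\<close> by auto
    define h where "h = min (e / 2) ((\<beta> - \<alpha>) / 2)"
    have "0 < h" "h < e" "h < \<beta> - \<alpha>"
      using e(1) \<open>\<alpha> < \<beta>\<close> by (auto simp: h_def min_def field_simps)
    then show False
      using e(2)[of h] Ppos[of "\<alpha> + h"] zero by auto
  qed
  ultimately show False
    by (simp add: mult_less_0_iff)
qed

text \<open>The image of the interval is connected and misses \<open>0\<close>. Returning the sign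
  as a factor lets arches of either sign be normalized to positive ones without a case
  split.\<close>

lemma nonvanishing_sign:
  fixes f :: "real \<Rightarrow> real"
  assumes "continuous_on {\<alpha><..<\<beta>} f" and "\<And>s. s \<in> {\<alpha><..<\<beta>} \<Longrightarrow> f s \<noteq> 0"
  obtains \<epsilon> :: real where "\<And>s. s \<in> {\<alpha><..<\<beta>} \<Longrightarrow> \<epsilon> * f s > 0"
proof -
  have "connected (f ` {\<alpha><..<\<beta>})"
    using assms(1) by (intro connected_continuous_image) auto
  then have "(\<forall>s\<in>{\<alpha><..<\<beta>}. f s > 0) \<or> (\<forall>s\<in>{\<alpha><..<\<beta>}. f s < 0)"
    using assms(2) connectedD_interval[of "f ` {\<alpha><..<\<beta>}" _ _ 0]
    by (smt (verit) imageE imageI)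
  then show thesis
    using that[of 1] that[of "-1"] by force
qed

text \<open>If the second gap were at least as long as the first, the arch after
  \<open>s\<^sub>2\<close>, reflected in \<open>s\<^sub>2\<close>, would be of one sign on all of
  \<open>{s\<^sub>1<..<s\<^sub>2}\<close>. The reflected solution has potential
  \<open>\<Phi> (2 * s\<^sub>2 - s)\<close>, which exceeds \<open>\<Phi> s\<close>, so the two
  arches violate the comparison above.\<close>

lemma sturm_gaps_decrease:
  fixes f g \<Phi> :: "real \<Rightarrow> real"
  assumes ord: "s\<^sub>1 < s\<^sub>2" "s\<^sub>2 < s\<^sub>3"
    and f: "\<And>s. s \<in> {s\<^sub>1..s\<^sub>3} \<Longrightarrow> (f has_real_derivative g s) (at s)"
    and g: "\<And>s. s \<in> {s\<^sub>1..s\<^sub>3} \<Longrightarrow> (g has_real_derivative - \<Phi> s * f s) (at s)"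
    and zero: "f s\<^sub>1 = 0" "f s\<^sub>2 = 0"
    and nz: "\<And>s. s \<in> {s\<^sub>1<..<s\<^sub>2} \<union> {s\<^sub>2<..<s\<^sub>3} \<Longrightarrow> f s \<noteq> 0"
    and mono: "\<And>s t. s\<^sub>1 \<le> s \<Longrightarrow> s < t \<Longrightarrow> t \<le> s\<^sub>3 \<Longrightarrow> \<Phi> s < \<Phi> t"
  shows "s\<^sub>3 - s\<^sub>2 < s\<^sub>2 - s\<^sub>1"
proof (rule ccontr)
  assume "\<not> ?thesis"
  then have le: "2 * s\<^sub>2 - s\<^sub>1 \<le> s\<^sub>3" by simp
  have cont: "continuous_on T f" if "T \<subseteq> {s\<^sub>1..s\<^sub>3}" for T
    using f DERIV_isCont that by (intro continuous_at_imp_continuous_on ballI) blast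
  obtain \<epsilon> where \<epsilon>: "\<And>s. s \<in> {s\<^sub>1<..<s\<^sub>2} \<Longrightarrow> \<epsilon> * f s > 0"
    by (rule nonvanishing_sign[of s\<^sub>1 s\<^sub>2 f]) (use nz ord in \<open>auto intro!: cont\<close>)
  obtain \<delta> where \<delta>: "\<And>s. s \<in> {s\<^sub>2<..<s\<^sub>3} \<Longrightarrow> \<delta> * f s > 0"
    by (rule nonvanishing_sign[of s\<^sub>2 s\<^sub>3 f]) (use nz ord in \<open>auto intro!: cont\<close>)
  show False
  proof (rule sturm_no_common_arch[OF ord(1)])
    fix s assume "s \<in> {s\<^sub>1..s\<^sub>2}"
    then have s: "s \<in> {s\<^sub>1..s\<^sub>3}" "2 * s\<^sub>2 - s \<in> {s\<^sub>1..s\<^sub>3}"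
      using ord le by auto
    show "((\<lambda>s. \<epsilon> * f s) has_real_derivative \<epsilon> * g s) (at s)"
      by (rule DERIV_cmult[OF f[OF s(1)]])
    show "((\<lambda>s. \<epsilon> * g s) has_real_derivative - \<Phi> s * (\<epsilon> * f s)) (at s)"
      by (rule derivative_eq_intros g[OF s(1)] refl)+ simp
    have r: "((\<lambda>s. 2 * s\<^sub>2 - s) has_real_derivative -1) (at s)"
      by (auto intro!: derivative_eq_intros)
    show "((\<lambda>s. \<delta> * f (2 * s\<^sub>2 - s)) has_real_derivative - \<delta> * g (2 * s\<^sub>2 - s)) (at s)"
      using DERIV_cmult[OF DERIV_chain2[OF f[OF s(2)] r], of \<delta>] by simp
    show "((\<lambda>s. - \<delta> * g (2 * s\<^sub>2 - s)) has_real_derivative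
        - \<Phi> (2 * s\<^sub>2 - s) * (\<delta> * f (2 * s\<^sub>2 - s))) (at s)"
      using DERIV_cmult[OF DERIV_chain2[OF g[OF s(2)] r], of "- \<delta>"] by (simp add: mult_ac)
  next
    fix s assume s: "s \<in> {s\<^sub>1<..<s\<^sub>2}"
    show "\<Phi> s < \<Phi> (2 * s\<^sub>2 - s)" "\<epsilon> * f s > 0" "\<delta> * f (2 * s\<^sub>2 - s) > 0"
      using s le ord by (auto intro!: mono \<epsilon> \<delta>)
  qed (use zero in auto)
qed

text \<open>The substitution of \<open>- s\<close> for \<open>s\<close> reverses the order of the
  zeros and turns a decreasing potential into an increasing one.\<close>

lemma sturm_gaps_increase:
  fixes f g \<Phi> :: "real \<Rightarrow> real"
  assumes ord: "s\<^sub>1 < s\<^sub>2" "s\<^sub>2 < s\<^sub>3"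
    and f: "\<And>s. s \<in> {s\<^sub>1..s\<^sub>3} \<Longrightarrow> (f has_real_derivative g s) (at s)"
    and g: "\<And>s. s \<in> {s\<^sub>1..s\<^sub>3} \<Longrightarrow> (g has_real_derivative - \<Phi> s * f s) (at s)"
    and zero: "f s\<^sub>2 = 0" "f s\<^sub>3 = 0"
    and nz: "\<And>s. s \<in> {s\<^sub>1<..<s\<^sub>2} \<union> {s\<^sub>2<..<s\<^sub>3} \<Longrightarrow> f s \<noteq> 0"
    and anti: "\<And>s t. s\<^sub>1 \<le> s \<Longrightarrow> s < t \<Longrightarrow> t \<le> s\<^sub>3 \<Longrightarrow> \<Phi> t < \<Phi> s"
  shows "s\<^sub>2 - s\<^sub>1 < s\<^sub>3 - s\<^sub>2"
proof -
  have m: "(uminus has_real_derivative -1) (at s)" for s :: real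
    by (auto intro!: derivative_eq_intros)
  have "- s\<^sub>1 - (- s\<^sub>2) < - s\<^sub>2 - (- s\<^sub>3)"
  proof (rule sturm_gaps_decrease[where f = "\<lambda>s. f (- s)" and g = "\<lambda>s. - g (- s)"
        and \<Phi> = "\<lambda>s. \<Phi> (- s)"])
    fix s assume "s \<in> {- s\<^sub>3..- s\<^sub>1}"
    then have s: "- s \<in> {s\<^sub>1..s\<^sub>3}" by auto
    show "((\<lambda>s. f (- s)) has_real_derivative - g (- s)) (at s)"
      using DERIV_chain2[OF f[OF s] m] by simp
    show "((\<lambda>s. - g (- s)) has_real_derivative - \<Phi> (- s) * f (- s)) (at s)"
      using DERIV_minus[OF DERIV_chain2[OF g[OF s] m]] by simp
  qed (use ord zero nz anti in auto)
  then show ?thesis by simp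
qed

text \<open>The system below is the equation \<open>f'' = - \<Phi> f\<close> in the independent variable \<open>t\<close>,
  where \<open>dt = \<rho> dx\<close>.\<close>

lemma liouville_gaps:
  fixes f g \<rho> t \<Phi> :: "real \<Rightarrow> real"
  assumes ord: "0 < x\<^sub>1" "x\<^sub>1 < x\<^sub>2" "x\<^sub>2 < x\<^sub>3"
    and \<rho>: "\<And>x. x > 0 \<Longrightarrow> \<rho> x > 0"
    and t: "\<And>x. x > 0 \<Longrightarrow> (t has_real_derivative \<rho> x) (at x)"
    and f: "\<And>x. x > 0 \<Longrightarrow> (f has_real_derivative \<rho> x * g x) (at x)"
    and g: "\<And>x. x > 0 \<Longrightarrow> (g has_real_derivative - \<rho> x * \<Phi> x * f x) (at x)"
    and zero: "f x\<^sub>1 = 0" "f x\<^sub>2 = 0" "f x\<^sub>3 = 0"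
    and nz: "\<And>x. x \<in> {x\<^sub>1<..<x\<^sub>2} \<union> {x\<^sub>2<..<x\<^sub>3} \<Longrightarrow> f x \<noteq> 0"
  shows "(\<And>x y. x\<^sub>1 \<le> x \<Longrightarrow> x < y \<Longrightarrow> y \<le> x\<^sub>3 \<Longrightarrow> \<Phi> x < \<Phi> y) \<Longrightarrow> t x\<^sub>3 - t x\<^sub>2 < t x\<^sub>2 - t x\<^sub>1"
    and "(\<And>x y. x\<^sub>1 \<le> x \<Longrightarrow> x < y \<Longrightarrow> y \<le> x\<^sub>3 \<Longrightarrow> \<Phi> y < \<Phi> x) \<Longrightarrow> t x\<^sub>2 - t x\<^sub>1 < t x\<^sub>3 - t x\<^sub>2"
proof -
  have mono: "t x < t y" if "0 < x" "x < y" for x y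
  proof (rule DERIV_pos_imp_increasing[OF that(2)])
    show "\<exists>D. (t has_real_derivative D) (at z) \<and> D > 0" if "x \<le> z" for z
      using t[of z] \<rho>[of z] that \<open>0 < x\<close> by auto
  qed
  have less_iff: "t x < t y \<longleftrightarrow> x < y" if "0 < x" "0 < y" for x y
    using that mono by (metis linorder_neqE_linordered_idom order_less_imp_not_less)
  \<comment> \<open>\<open>X\<close> inverts the strictly increasing \<open>t\<close> on the
    positive half-line. Along \<open>X\<close> the factor \<open>\<rho>\<close> cancels against
    \<open>inverse (\<rho> x)\<close>, so \<open>f (X s)\<close> and \<open>g (X s)\<close> satisfy
    exactly the system required for Sturm comparison.\<close>
  define X where "X = inv_into {0<..} t"
  have X: "X (t x) = x" if "x > 0" for x
  proof -
    have "inj_on t {0<..}"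
      using mono by (intro linorder_inj_onI) (auto simp: less_imp_neq)
    then show ?thesis
      using that by (simp add: X_def)
  qed
  have dX: "(X has_real_derivative inverse (\<rho> x)) (at (t x))" if "x > 0" for x
    unfolding has_field_derivative_def
  proof (rule has_derivative_inverse_strong[where S = "{0<..}" and f = t and f' = "(*) (\<rho> x)"])
    show "open {0::real<..}" "x \<in> {0<..}"
      using that by auto
    show "continuous_on {0<..} t"
      using t DERIV_isCont by (intro continuous_at_imp_continuous_on ballI) blast
    show "(t has_derivative (*) (\<rho> x)) (at x)"
      using t[OF that] by (simp add: has_field_derivative_def)
    show "(*) (\<rho> x) \<circ> (*) (inverse (\<rho> x)) = id"
      using \<rho>[OF that] by (auto simp: fun_eq_iff)
  qed (use X in auto)
  \<comment> \<open>By the intermediate value theorem every \<open>s\<close> in the transformed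
    interval is some \<open>t x\<close>, so statements about \<open>s\<close> can be checked at
    \<open>x\<close>.\<close>
  have ex: "\<exists>x. x \<in> {x\<^sub>1..x\<^sub>3} \<and> s = t x" if "s \<in> {t x\<^sub>1..t x\<^sub>3}" for s
  proof -
    have "continuous_on {x\<^sub>1..x\<^sub>3} t"
      using ord by (intro DERIV_continuous_on[where D = \<rho>] DERIV_subset[OF t]) auto
    then show ?thesis
      using IVT'[of t x\<^sub>1 s x\<^sub>3] that ord by auto
  qed
  have df: "((\<lambda>s. f (X s)) has_real_derivative g (X s)) (at s)" if "s \<in> {t x\<^sub>1..t x\<^sub>3}" for s
  proof -
    obtain x where x: "x \<in> {x\<^sub>1..x\<^sub>3}" "s = t x" using ex \<open>s \<in> _\<close> by blast
    then have "x > 0" using ord by auto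
    then show ?thesis
      using DERIV_chain2[OF _ dX, of f "\<rho> x * g x" x] f[of x] \<rho>[of x] X[of x] x
      by (simp add: field_simps)
  qed
  have dg: "((\<lambda>s. g (X s)) has_real_derivative - \<Phi> (X s) * f (X s)) (at s)"
    if "s \<in> {t x\<^sub>1..t x\<^sub>3}" for s
  proof -
    obtain x where x: "x \<in> {x\<^sub>1..x\<^sub>3}" "s = t x" using ex \<open>s \<in> _\<close> by blast
    then have "x > 0" using ord by auto
    then show ?thesis
      using DERIV_chain2[OF _ dX, of g "- \<rho> x * \<Phi> x * f x" x] g[of x] \<rho>[of x] X[of x] x
      by (simp add: field_simps)
  qed
  have tord: "t x\<^sub>1 < t x\<^sub>2" "t x\<^sub>2 < t x\<^sub>3"
    using mono ord by auto
  have tzero: "f (X (t x\<^sub>1)) = 0" "f (X (t x\<^sub>2)) = 0" "f (X (t x\<^sub>3)) = 0"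
    using X zero ord by auto
  have tnz: "f (X s) \<noteq> 0" if "s \<in> {t x\<^sub>1<..<t x\<^sub>2} \<union> {t x\<^sub>2<..<t x\<^sub>3}" for s
  proof -
    have "s \<in> {t x\<^sub>1..t x\<^sub>3}" using that tord by auto
    then obtain x where x: "x \<in> {x\<^sub>1..x\<^sub>3}" "s = t x" using ex by blast
    then have "x > 0" using ord by auto
    then show ?thesis
      using x that nz[of x] X[of x] less_iff ord by auto
  qed
  have le_X: "x\<^sub>1 \<le> X s \<and> X s < X r \<and> X r \<le> x\<^sub>3" if sr: "t x\<^sub>1 \<le> s" "s < r" "r \<le> t x\<^sub>3" for s r
  proof -
    obtain x y where "x \<in> {x\<^sub>1..x\<^sub>3}" "s = t x" "y \<in> {x\<^sub>1..x\<^sub>3}" "r = t y"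
      using ex[of s] ex[of r] sr by auto
    then show ?thesis
      using X[of x] X[of y] less_iff[of x y] sr ord by auto
  qed
  show "t x\<^sub>3 - t x\<^sub>2 < t x\<^sub>2 - t x\<^sub>1"
    if "\<And>x y. x\<^sub>1 \<le> x \<Longrightarrow> x < y \<Longrightarrow> y \<le> x\<^sub>3 \<Longrightarrow> \<Phi> x < \<Phi> y"
    by (rule sturm_gaps_decrease[OF tord df dg]) (use tzero tnz that le_X in auto)
  show "t x\<^sub>2 - t x\<^sub>1 < t x\<^sub>3 - t x\<^sub>2"
    if "\<And>x y. x\<^sub>1 \<le> x \<Longrightarrow> x < y \<Longrightarrow> y \<le> x\<^sub>3 \<Longrightarrow> \<Phi> y < \<Phi> x"
    by (rule sturm_gaps_increase[OF tord df dg]) (use tzero tnz that le_X in auto)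
qed

text \<open>Liouville's substitution: \<open>f = \<surd>\<rho> w\<close> and
  \<open>g = f' / \<rho>\<close>. In \<open>g'\<close> the terms with \<open>w'\<close> cancel, and
  the remaining multiple of \<open>w\<close> is \<open>- (G + l^2/4 - l'/2) / \<surd>\<rho>\<close>.
  The hypothesis on \<open>\<Phi>\<close>, multiplied out by \<open>\<rho>^2\<close>, identifies
  this as \<open>- \<rho> \<Phi> f\<close>.\<close>

lemma normal_form_gaps:
  fixes w w' G \<rho> l l' t \<Phi> :: "real \<Rightarrow> real"
  assumes ord: "0 < x\<^sub>1" "x\<^sub>1 < x\<^sub>2" "x\<^sub>2 < x\<^sub>3"
    and w: "\<And>x. x > 0 \<Longrightarrow> (w has_real_derivative w' x) (at x)"
    and w': "\<And>x. x > 0 \<Longrightarrow> (w' has_real_derivative - G x * w x) (at x)"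
    and zero: "w x\<^sub>1 = 0" "w x\<^sub>2 = 0" "w x\<^sub>3 = 0"
    and nz: "\<And>x. x \<in> {x\<^sub>1<..<x\<^sub>2} \<union> {x\<^sub>2<..<x\<^sub>3} \<Longrightarrow> w x \<noteq> 0"
    and \<rho>: "\<And>x. x > 0 \<Longrightarrow> \<rho> x > 0"
    and t: "\<And>x. x > 0 \<Longrightarrow> (t has_real_derivative \<rho> x) (at x)"
    and d\<rho>: "\<And>x. x > 0 \<Longrightarrow> (\<rho> has_real_derivative l x * \<rho> x) (at x)"
    and l: "\<And>x. x > 0 \<Longrightarrow> (l has_real_derivative l' x) (at x)"
    and \<Phi>: "\<And>x. x > 0 \<Longrightarrow> \<Phi> x * (\<rho> x)\<^sup>2 = G x + (l x)\<^sup>2 / 4 - l' x / 2"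
  shows "(\<And>x y. x\<^sub>1 \<le> x \<Longrightarrow> x < y \<Longrightarrow> y \<le> x\<^sub>3 \<Longrightarrow> \<Phi> x < \<Phi> y) \<Longrightarrow> t x\<^sub>3 - t x\<^sub>2 < t x\<^sub>2 - t x\<^sub>1"
    and "(\<And>x y. x\<^sub>1 \<le> x \<Longrightarrow> x < y \<Longrightarrow> y \<le> x\<^sub>3 \<Longrightarrow> \<Phi> y < \<Phi> x) \<Longrightarrow> t x\<^sub>2 - t x\<^sub>1 < t x\<^sub>3 - t x\<^sub>2"
proof -
  define f where "f x = sqrt (\<rho> x) * w x" for x
  define g where "g x = (l x * w x / 2 + w' x) / sqrt (\<rho> x)" for x
  have sq: "sqrt (\<rho> x) * sqrt (\<rho> x) = \<rho> x" "sqrt (\<rho> x) > 0" if "x > 0" for x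
    using \<rho>[OF that] by auto
  have ds: "((\<lambda>x. sqrt (\<rho> x)) has_real_derivative l x / 2 * sqrt (\<rho> x)) (at x)" if "x > 0" for x
    using DERIV_chain2[OF DERIV_real_sqrt[OF \<rho>[OF that]] d\<rho>[OF that]] sq[OF that]
    by (auto elim!: DERIV_cong simp: field_simps)
  have f: "(f has_real_derivative \<rho> x * g x) (at x)" if "x > 0" for x
  proof -
    have "\<rho> x * g x = sqrt (\<rho> x) * (l x * w x / 2 + w' x)"
      unfolding g_def using sq[OF that] by (metis less_irrefl mult.assoc nonzero_mult_div_cancel_left times_divide_eq_right)
    then show ?thesis
      unfolding f_def using DERIV_mult[OF ds[OF that] w[OF that]]
      by (auto elim!: DERIV_cong simp: algebra_simps)
  qed
  have g: "(g has_real_derivative - \<rho> x * \<Phi> x * f x) (at x)" if "x > 0" for x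
  proof -
    define r where "r = sqrt (\<rho> x)"
    have r: "r > 0" "\<rho> x = r * r" using sq[OF that] by (auto simp: r_def)
    have eq: "\<Phi> x * (r * r * r * r) = G x + (l x)\<^sup>2 / 4 - l' x / 2"
      using \<Phi>[OF that] by (simp add: r power2_eq_square mult_ac)
    have "- \<rho> x * \<Phi> x * f x = - (\<Phi> x * (r * r * r * r)) * w x / r"
      using r(1) by (simp add: f_def r(2) field_simps flip: r_def)
    also have "\<dots> = - (G x + (l x)\<^sup>2 / 4 - l' x / 2) * w x / r"
      by (simp only: eq)
    finally have goal: "- \<rho> x * \<Phi> x * f x = \<dots>" .
    have "r \<noteq> 0" using r by simp
    show ?thesis
      unfolding goal g_def
      by (rule DERIV_cong[OF DERIV_divide[OF DERIV_add[OF DERIV_cdivide[OF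
            DERIV_mult[OF l[OF that] w[OF that]]] w'[OF that]] ds[OF that]]])
        (use \<open>r \<noteq> 0\<close> in \<open>simp_all add: r_def[symmetric] field_simps power2_eq_square\<close>)
  qed
  have fz: "f x = 0 \<longleftrightarrow> w x = 0" if "x > 0" for x
    using sq(2)[OF that] by (simp add: f_def)
  note hyps = ord \<rho> t f g
  show "t x\<^sub>3 - t x\<^sub>2 < t x\<^sub>2 - t x\<^sub>1"
    if "\<And>x y. x\<^sub>1 \<le> x \<Longrightarrow> x < y \<Longrightarrow> y \<le> x\<^sub>3 \<Longrightarrow> \<Phi> x < \<Phi> y"
    by (rule liouville_gaps(1)[OF hyps]) (use fz zero nz ord that in auto)
  show "t x\<^sub>2 - t x\<^sub>1 < t x\<^sub>3 - t x\<^sub>2"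
    if "\<And>x y. x\<^sub>1 \<le> x \<Longrightarrow> x < y \<Longrightarrow> y \<le> x\<^sub>3 \<Longrightarrow> \<Phi> y < \<Phi> x"
    by (rule liouville_gaps(2)[OF hyps]) (use fz zero nz ord that in auto)
qed

section \<open>Bessel functions\<close>

definition bessel_coeff :: "real \<Rightarrow> nat \<Rightarrow> real" where
  "bessel_coeff a m = (-1) ^ m * rGamma (real m + a + 1) / fact m"

text \<open>The Bessel-Clifford function at \<open>- z\<close>, that is, the entire factor in
  \<open>J_a(x) = (x/2)^a E_a(x^2/4)\<close>. It carries the power series arguments free of real
  powers.\<close>

definition bessel_E :: "real \<Rightarrow> real \<Rightarrow> real" where
  "bessel_E a z = (\<Sum>m. bessel_coeff a m * z ^ m)"

lemma bessel_coeff_Suc: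
  assumes "a > -1"
  shows "bessel_coeff a (Suc m) = - bessel_coeff a m / ((real m + 1) * (real m + a + 1))"
proof -
  have "real m + a + 1 > 0" using assms by linarith
  moreover have "rGamma (real m + a + 1) = (real m + a + 1) * rGamma (real m + a + 1 + 1)"
    by (simp only: rGamma_plus1)
  ultimately have "rGamma (real (Suc m) + a + 1) = rGamma (real m + a + 1) / (real m + a + 1)"
    by (simp add: add_ac)
  then show ?thesis
    by (simp add: bessel_coeff_def field_simps)
qed

lemma summable_bessel_coeff:
  assumes "a > -1"
  shows "summable (\<lambda>m. bessel_coeff a m * z ^ m)"
proof (rule summable_ratio_test)
  \<comment> \<open>From this index on, \<open>m + 1\<close> is at least
    \<open>2 * \<bar>z\<bar>\<close> and \<open>m + a + 1\<close> is at least \<open>1\<close>, so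
    the ratio of consecutive terms is at most \<open>1/2\<close>.\<close>
  fix m assume m: "m \<ge> nat \<lceil>2 * \<bar>z\<bar>\<rceil> + 1"
  have *: "real m + a + 1 \<ge> 1" "real m + 1 \<ge> 2 * \<bar>z\<bar>"
    using assms m by linarith+
  have "2 * \<bar>z\<bar> \<le> (real m + 1) * 1"
    using * by simp
  also have "\<dots> \<le> (real m + 1) * (real m + a + 1)"
    using * by (intro mult_left_mono) auto
  finally have "\<bar>z\<bar> \<le> 1 / 2 * ((real m + 1) * (real m + a + 1))"
    by simp
  then have "\<bar>z\<bar> / ((real m + 1) * (real m + a + 1)) \<le> 1 / 2"
    using * by (subst pos_divide_le_eq) (auto intro!: mult_pos_pos)
  then have "\<bar>z\<bar> / ((real m + 1) * (real m + a + 1)) * norm (bessel_coeff a m * z ^ m)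
      \<le> 1 / 2 * norm (bessel_coeff a m * z ^ m)"
    by (rule mult_right_mono) simp
  moreover have "norm (bessel_coeff a (Suc m) * z ^ Suc m)
      = \<bar>z\<bar> / ((real m + 1) * (real m + a + 1)) * norm (bessel_coeff a m * z ^ m)"
    using * by (simp add: bessel_coeff_Suc[OF assms] abs_mult power_abs)
  ultimately show "norm (bessel_coeff a (Suc m) * z ^ Suc m)
      \<le> 1 / 2 * norm (bessel_coeff a m * z ^ m)"
    by simp
qed auto

text \<open>Termwise differentiation replaces \<open>m\<close> by \<open>m + 1\<close> inside
  \<open>rGamma\<close>, which is the same as raising the order by one; the alternating sign
  supplies the minus.\<close>

lemma bessel_E_deriv:
  assumes "a > -1"
  shows "(bessel_E a has_real_derivative - bessel_E (a + 1) z) (at z)"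
proof -
  have "diffs (bessel_coeff a) m = - bessel_coeff (a + 1) m" for m
  proof -
    have "real (Suc m) + a + 1 = real m + (a + 1) + 1" by simp
    then show ?thesis
      unfolding diffs_def bessel_coeff_def by (simp only:) (simp del: of_nat_Suc)
  qed
  then have "(\<Sum>m. diffs (bessel_coeff a) m * z ^ m) = - bessel_E (a + 1) z"
    using assms by (simp add: bessel_E_def suminf_minus summable_bessel_coeff)
  then show ?thesis
    using termdiffs_strong_converges_everywhere[OF summable_bessel_coeff[OF assms], of z]
    by (simp add: bessel_E_def[abs_def])
qed

lemma bessel_E_recurrence:
  assumes "a > -1"
  shows "bessel_E a z = (a + 1) * bessel_E (a + 1) z - z * bessel_E (a + 2) z"
proof -
  have s: "(\<lambda>m. bessel_coeff p m * z ^ m) sums bessel_E p z" if "p > -1" for p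
    unfolding bessel_E_def by (rule summable_sums[OF summable_bessel_coeff[OF that]])
  \<comment> \<open>The functional equation of \<open>rGamma\<close> gives each term of
    \<open>E_a\<close> a factor \<open>m + a + 1\<close> over the term of \<open>E_(a+1)\<close>.
    The part \<open>a + 1\<close> yields the first summand; \<open>h\<close> is the part
    \<open>m\<close>, which vanishes at \<open>m = 0\<close> and after an index shift becomes the
    series of \<open>- z E_(a+2)\<close>.\<close>
  define h where "h m = real m * bessel_coeff (a + 1) m * z ^ m" for m
  have "h (Suc m) = - z * (bessel_coeff (a + 2) m * z ^ m)" for m
    by (simp add: h_def bessel_coeff_def add_ac field_simps del: of_nat_Suc) (simp add: add_ac)
  then have "(\<lambda>m. h (Suc m)) sums (- z * bessel_E (a + 2) z)"
    using sums_mult[OF s[of "a + 2"], of "- z"] assms by simp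
  then have "h sums (- z * bessel_E (a + 2) z)"
    by (subst (asm) sums_Suc_iff) (simp add: h_def)
  then have "(\<lambda>m. (a + 1) * (bessel_coeff (a + 1) m * z ^ m) + h m) sums
      ((a + 1) * bessel_E (a + 1) z + - z * bessel_E (a + 2) z)"
    using assms by (intro sums_add sums_mult s) auto
  moreover have "(a + 1) * (bessel_coeff (a + 1) m * z ^ m) + h m = bessel_coeff a m * z ^ m" for m
  proof -
    have "rGamma (real m + a + 1) = (real m + a + 1) * rGamma (real m + a + 1 + 1)"
      by (simp only: rGamma_plus1)
    then show ?thesis
      by (simp add: h_def bessel_coeff_def field_simps)
  qed
  ultimately show ?thesis
    using s[OF assms] sums_unique2 by fastforce
qed

text \<open>For \<open>z < a + 1\<close> the series alternates with terms decreasing from the very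
  first one, so its sum is at least that of the first two terms,
  \<open>q 0 * (1 - z / (a + 1)) > 0\<close>.\<close>

lemma bessel_E_pos:
  assumes "a > -1" "0 < z" "z < a + 1"
  shows "bessel_E a z > 0"
proof -
  define q where "q m = rGamma (real m + a + 1) / fact m * z ^ m" for m
  have eq: "bessel_coeff a m * z ^ m = (-1) ^ m * q m" for m
    by (simp add: bessel_coeff_def q_def)
  have q_eq: "q m = (-1) ^ m * (bessel_coeff a m * z ^ m)" for m
    by (simp add: eq)
  have q_pos: "q m > 0" for m
    using assms by (simp add: q_def rGamma_inverse_Gamma Gamma_real_pos)
  have q_Suc: "q (Suc m) = z / ((real m + 1) * (real m + a + 1)) * q m" for m
    unfolding q_eq bessel_coeff_Suc[OF assms(1)] by simp
  have "(\<lambda>m. \<bar>(-1) ^ m * q m\<bar>) \<longlonglongrightarrow> 0"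
    using summable_LIMSEQ_zero[OF summable_bessel_coeff[OF assms(1), of z]] tendsto_rabs_zero
    unfolding eq by blast
  then have lim: "q \<longlonglongrightarrow> 0"
    using q_pos by (simp add: abs_mult power_abs less_imp_le)
  have dec: "q (Suc m) \<le> q m" for m
  proof -
    have "1 * (a + 1) \<le> (real m + 1) * (real m + a + 1)"
      using assms by (intro mult_mono) auto
    then have "z / ((real m + 1) * (real m + a + 1)) \<le> 1"
      using assms by (simp add: divide_le_eq)
    then show ?thesis
      unfolding q_Suc using q_pos[of m] by (intro mult_left_le_one_le) (use assms in auto)
  qed
  \<comment> \<open>Partial sums with an even number \<open>2 * n\<close> of terms bound an
    alternating series from below; here \<open>n = 1\<close>.\<close>
  have "(\<Sum>i<2 * 1. (-1) ^ i * q i) \<le> bessel_E a z"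
    unfolding bessel_E_def eq
    by (rule summable_Leibniz'(2)[OF lim _ dec]) (use q_pos less_imp_le in auto)
  moreover have "(\<Sum>i<2 * 1. (-1) ^ i * q i) = q 0 * (1 - z / (a + 1))"
    using q_Suc[of 0] by (simp add: numeral_2_eq_2 algebra_simps)
  ultimately show ?thesis
    using q_pos[of 0] assms by (smt (verit) divide_less_eq_1_pos mult_pos_pos)
qed

lemma Bessel_J_eq:
  assumes "a > -1" "x > 0"
  shows "Bessel_J a x = (x / 2) powr a * bessel_E a ((x / 2)\<^sup>2)"
proof -
  have "(x / 2) powr (2 * real m + a) = (x / 2) powr a * ((x / 2)\<^sup>2) ^ m" for m
    using assms powr_realpow[of "x / 2" "2 * m"] by (simp add: powr_add mult.commute flip: power_mult)
  then have "Bessel_J a x = (\<Sum>m. (x / 2) powr a * (bessel_coeff a m * ((x / 2)\<^sup>2) ^ m))"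
    by (simp add: Bessel_J_def bessel_coeff_def mult_ac)
  then show ?thesis
    by (simp add: bessel_E_def suminf_mult[OF summable_bessel_coeff[OF assms(1)]])
qed

lemma Bessel_J_pos:
  assumes "a > -1" "x > 0" "(x / 2)\<^sup>2 < a + 1"
  shows "Bessel_J a x > 0"
  using assms by (simp add: Bessel_J_eq bessel_E_pos)

lemma Bessel_J_recurrence:
  assumes "a > -1" "x > 0"
  shows "Bessel_J (a + 2) x = 2 * (a + 1) / x * Bessel_J (a + 1) x - Bessel_J a x"
proof -
  define P where "P = (x / 2) powr a"
  have J: "Bessel_J a x = P * bessel_E a ((x / 2)\<^sup>2)"
    "Bessel_J (a + 1) x = P * (x / 2) * bessel_E (a + 1) ((x / 2)\<^sup>2)"
    "Bessel_J (a + 2) x = P * (x / 2)\<^sup>2 * bessel_E (a + 2) ((x / 2)\<^sup>2)"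
    using assms powr_numeral[of "x / 2"] by (simp_all add: Bessel_J_eq P_def powr_add)
  have cancel: "2 * (a + 1) / x * (P * (x / 2) * q) = P * ((a + 1) * q)" for q
    using assms by (simp add: field_simps)
  show ?thesis
    unfolding J cancel bessel_E_recurrence[OF assms(1), of "(x / 2)\<^sup>2"]
    by (simp add: right_diff_distrib)
qed

lemma Bessel_J_deriv:
  assumes "a > -1" "x > 0"
  shows "(Bessel_J a has_real_derivative a / x * Bessel_J a x - Bessel_J (a + 1) x) (at x)"
proof -
  have J: "Bessel_J (a + 1) x = (x / 2) powr a * (x / 2) * bessel_E (a + 1) ((x / 2)\<^sup>2)"
    using assms by (simp add: Bessel_J_eq powr_add)
  have sq: "((\<lambda>x. (x / 2)\<^sup>2) has_real_derivative x / 2) (at x)"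
    by (auto intro!: derivative_eq_intros simp: power2_eq_square)
  have "((\<lambda>x. (x / 2) powr a) has_real_derivative a / x * (x / 2) powr a) (at x)"
    using assms by (auto intro!: derivative_eq_intros simp: powr_diff)
  from DERIV_mult[OF this DERIV_chain2[OF bessel_E_deriv[OF assms(1)] sq]]
  have "((\<lambda>x. (x / 2) powr a * bessel_E a ((x / 2)\<^sup>2)) has_real_derivative
      a / x * Bessel_J a x - Bessel_J (a + 1) x) (at x)"
    using assms by (auto elim!: DERIV_cong simp: Bessel_J_eq[of a] J mult_ac)
  \<comment> \<open>The factorization of \<open>Bessel_J\<close> is available only for positive
    arguments, so the derivative is transferred on the open half-line.\<close>
  then show ?thesis
    by (rule has_field_derivative_transform_within_open[of _ _ _ "{0<..}"])
      (use assms in \<open>auto simp: Bessel_J_eq\<close>)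
qed

lemma Bessel_J_deriv':
  assumes "a > -1" "x > 0"
  shows "(Bessel_J (a + 1) has_real_derivative
    Bessel_J a x - (a + 1) / x * Bessel_J (a + 1) x) (at x)"
  using Bessel_J_deriv[of "a + 1" x] Bessel_J_recurrence[OF assms] assms
  by (auto elim!: DERIV_cong simp: field_simps)

section \<open>Normal form of the combination of two Bessel functions\<close>

text \<open>Elimination of \<open>v\<close> from a trace-free system. The hypotheses on
  \<open>B\<close> and \<open>m\<close> say that \<open>m\<close> is a constant multiple of
  \<open>B^(-1/2)\<close> where \<open>B > 0\<close>; with this weight all terms in \<open>v\<close>
  cancel from the second derivative of \<open>m u\<close>.\<close>

lemma first_order_system_normal_form:
  fixes u v A B D m \<mu> :: "real \<Rightarrow> real"
  assumes u: "(u has_real_derivative A x * u x - B x * v x) (at x)"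
    and v: "(v has_real_derivative D x * u x - A x * v x) (at x)"
    and A: "(A has_real_derivative A') (at x)"
    and B: "(B has_real_derivative - 2 * \<mu> x * B x) (at x)"
    and m: "(m has_real_derivative \<mu> x * m x) (at x)"
    and \<mu>: "(\<mu> has_real_derivative \<mu>') (at x)"
  shows "((\<lambda>x. m x * u x) has_real_derivative m x * ((\<mu> x + A x) * u x - B x * v x)) (at x)"
    and "((\<lambda>x. m x * ((\<mu> x + A x) * u x - B x * v x)) has_real_derivative
      - (B x * D x - (\<mu> x + A x)\<^sup>2 - \<mu>' - A') * (m x * u x)) (at x)"
proof -
  show "((\<lambda>x. m x * u x) has_real_derivative m x * ((\<mu> x + A x) * u x - B x * v x)) (at x)"
    by (rule DERIV_cong[OF DERIV_mult[OF m u]]) (simp add: algebra_simps)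
  show "((\<lambda>x. m x * ((\<mu> x + A x) * u x - B x * v x)) has_real_derivative
      - (B x * D x - (\<mu> x + A x)\<^sup>2 - \<mu>' - A') * (m x * u x)) (at x)"
    by (rule DERIV_cong[OF DERIV_mult[OF m DERIV_diff[OF
            DERIV_mult[OF DERIV_add[OF \<mu> A] u] DERIV_mult[OF B v]]]])
      (simp add: algebra_simps power2_eq_square)
qed

text \<open>If \<open>\<theta>\<close> is the angle of the vector \<open>(c, d)\<close>, then
  \<open>\<sigma> = b sin 2\<theta>\<close> and \<open>e = b cos 2\<theta>\<close>.\<close>

lemma rotation_coeffs_pythagoras:
  fixes a b c d e \<sigma> :: real
  assumes "c \<noteq> 0" "d \<noteq> 0" and b: "b = a + 1/2"
    and \<sigma>: "\<sigma> = (2 * a + 1) * c * d / (c\<^sup>2 + d\<^sup>2)" and e: "e = b * (c\<^sup>2 - d\<^sup>2) / (c\<^sup>2 + d\<^sup>2)"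
  shows "\<sigma>\<^sup>2 + e\<^sup>2 = b\<^sup>2"
proof -
  have N: "c\<^sup>2 + d\<^sup>2 > 0"
    using assms by (simp add: sum_power2_gt_zero_iff)
  have "\<sigma> * (c\<^sup>2 + d\<^sup>2) = 2 * b * c * d" and "e * (c\<^sup>2 + d\<^sup>2) = b * (c\<^sup>2 - d\<^sup>2)"
    using N by (auto simp: \<sigma> e b)
  then have "(\<sigma>\<^sup>2 + e\<^sup>2) * (c\<^sup>2 + d\<^sup>2)\<^sup>2 = b\<^sup>2 * (c\<^sup>2 + d\<^sup>2)\<^sup>2"
    by algebra
  then show ?thesis
    using N by auto
qed

text \<open>The potential \<open>B D - (\<mu> + A)^2 - \<mu>' - A'\<close> of the preceding
  elimination for \<open>A = e/x\<close>, \<open>B = 1 + \<sigma>/x\<close>,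
  \<open>D = 1 - \<sigma>/x\<close>, simplified by \<open>\<sigma>^2 + e^2 = b^2\<close>.\<close>

definition bessel_comb_potential :: "real \<Rightarrow> real \<Rightarrow> real \<Rightarrow> real \<Rightarrow> real" where
  "bessel_comb_potential b e \<sigma> x =
     1 - (b\<^sup>2 - 1/4) / x\<^sup>2 + (e + 1/2) / (x * (x + \<sigma>)) - 3/4 / (x + \<sigma>)\<^sup>2"

text \<open>Since \<open>\<surd>x J\<^sub>a\<close> and \<open>\<surd>x J\<^sub>a\<^sub>+\<^sub>1\<close> satisfy \<open>y' = b y / x - z\<close>, \<open>z' = y - b z / x\<close> with
  \<open>b = a + 1/2\<close>, rotating this pair by the direction \<open>(c, d)\<close> gives a system with off-diagonal
  coefficients \<open>-(1 + \<sigma>/x)\<close> and \<open>1 - \<sigma>/x\<close>.\<close>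

lemma bessel_comb_normal_form:
  fixes a b c d e \<sigma> :: real
  assumes a: "a > -1" and nz: "c \<noteq> 0" "d \<noteq> 0"
    and b: "b = a + 1/2" and \<sigma>: "\<sigma> = (2 * a + 1) * c * d / (c\<^sup>2 + d\<^sup>2)" "\<sigma> > 0"
    and e: "e = b * (c\<^sup>2 - d\<^sup>2) / (c\<^sup>2 + d\<^sup>2)"
  obtains w w' :: "real \<Rightarrow> real"
  where "\<And>x. x > 0 \<Longrightarrow> (w has_real_derivative w' x) (at x)"
    and "\<And>x. x > 0 \<Longrightarrow> (w' has_real_derivative - bessel_comb_potential b e \<sigma> x * w x) (at x)"
    and "\<And>x. x > 0 \<Longrightarrow> w x = 0 \<longleftrightarrow> x \<in> bessel_pos_zeros a c d"
proof -
  define y z where "y x = sqrt x * Bessel_J a x" and "z x = sqrt x * Bessel_J (a + 1) x" for x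
  define u v where "u x = c * y x + d * z x" and "v x = c * z x - d * y x" for x
  \<comment> \<open>\<open>m\<close> is \<open>(1 + \<sigma>/x)^(-1/2)\<close>, the weight demanded
    by the off-diagonal coefficient \<open>1 + \<sigma>/x\<close>, and \<open>\<mu>\<close> is its
    logarithmic derivative.\<close>
  define m \<mu> where "m x = sqrt (x / (x + \<sigma>))" and "\<mu> x = (1 / x - 1 / (x + \<sigma>)) / 2" for x
  define w where "w x = m x * u x" for x
  define w' where "w' x = m x * ((\<mu> x + e / x) * u x - (1 + \<sigma> / x) * v x)" for x
  have N: "c\<^sup>2 + d\<^sup>2 > 0" using nz by (simp add: sum_power2_gt_zero_iff)
  have \<sigma>b: "\<sigma> * (c\<^sup>2 + d\<^sup>2) = 2 * b * c * d" and eb: "e * (c\<^sup>2 + d\<^sup>2) = b * (c\<^sup>2 - d\<^sup>2)"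
    using N by (auto simp: \<sigma> e b)
  \<comment> \<open>\<open>(c, d)\<close> is an eigenvector, with eigenvalue \<open>b\<close>, of
    the symmetric matrix with rows \<open>(e, \<sigma>)\<close> and \<open>(\<sigma>, - e)\<close>.
    These relations produce the coefficients of the rotated system.\<close>
  have rot: "b * c = e * c + \<sigma> * d" "b * d = \<sigma> * c - e * d"
  proof -
    have "(e * c + \<sigma> * d) * (c\<^sup>2 + d\<^sup>2) = b * c * (c\<^sup>2 + d\<^sup>2)"
      "(\<sigma> * c - e * d) * (c\<^sup>2 + d\<^sup>2) = b * d * (c\<^sup>2 + d\<^sup>2)"
      using \<sigma>b eb by algebra+
    then show "b * c = e * c + \<sigma> * d" "b * d = \<sigma> * c - e * d"
      using N by auto
  qed
  have bb: "\<sigma>\<^sup>2 + e\<^sup>2 = b\<^sup>2"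
    by (rule rotation_coeffs_pythagoras[OF nz b \<sigma>(1) e])
  have y: "(y has_real_derivative b / x * y x - z x) (at x)"
    and z: "(z has_real_derivative y x - b / x * z x) (at x)" if "x > 0" for x
  proof -
    have s: "(sqrt has_real_derivative 1 / (2 * x) * sqrt x) (at x)"
      using that by (rule_tac DERIV_cong[OF DERIV_real_sqrt]) (auto simp: field_simps)
    show "(y has_real_derivative b / x * y x - z x) (at x)"
      unfolding y_def z_def
      by (rule DERIV_cong[OF DERIV_mult[OF s Bessel_J_deriv[OF a that]]])
        (use that in \<open>simp add: b field_simps\<close>)
    show "(z has_real_derivative y x - b / x * z x) (at x)"
      unfolding y_def z_def
      by (rule DERIV_cong[OF DERIV_mult[OF s Bessel_J_deriv'[OF a that]]])
        (use that in \<open>simp add: b field_simps\<close>)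
  qed
  have u: "(u has_real_derivative e / x * u x - (1 + \<sigma> / x) * v x) (at x)"
    and v: "(v has_real_derivative (1 - \<sigma> / x) * u x - e / x * v x) (at x)" if "x > 0" for x
  proof -
    define p where "p = 1 / x"
    have p: "q / x = q * p" for q by (simp add: p_def)
    show "(u has_real_derivative e / x * u x - (1 + \<sigma> / x) * v x) (at x)"
      unfolding u_def v_def
      by (rule DERIV_cong[OF DERIV_add[OF DERIV_cmult[OF y[OF that]] DERIV_cmult[OF z[OF that]]]])
        (unfold p, use rot in algebra)
    show "(v has_real_derivative (1 - \<sigma> / x) * u x - e / x * v x) (at x)"
      unfolding u_def v_def
      by (rule DERIV_cong[OF DERIV_diff[OF DERIV_cmult[OF z[OF that]] DERIV_cmult[OF y[OF that]]]])
        (unfold p, use rot in algebra)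
  qed
  have m: "(m has_real_derivative \<mu> x * m x) (at x)" if "x > 0" for x
  proof -
    define r where "r = sqrt (x / (x + \<sigma>))"
    have r: "r > 0" "r * r = x / (x + \<sigma>)" "x / (x + \<sigma>) > 0"
      using that \<sigma>(2) by (auto simp: r_def)
    have "((\<lambda>x. x / (x + \<sigma>)) has_real_derivative \<sigma> / (x + \<sigma>)\<^sup>2) (at x)"
      using that \<sigma>(2) by (auto intro!: derivative_eq_intros simp: power2_eq_square)
    from DERIV_chain2[OF DERIV_real_sqrt[OF r(3)] this]
    have "(m has_real_derivative inverse r / 2 * (\<sigma> / (x + \<sigma>)\<^sup>2)) (at x)"
      by (simp add: m_def[abs_def] r_def)
    moreover have "inverse r / 2 * (\<sigma> / (x + \<sigma>)\<^sup>2) = \<mu> x * r"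
    proof -
      have "\<mu> x * (r * r) = \<sigma> / (x + \<sigma>)\<^sup>2 / 2"
        unfolding r(2) \<mu>_def using that \<sigma>(2) by (simp add: divide_simps) algebra
      moreover have "\<mu> x * r = \<mu> x * (r * r) * inverse r" using r(1) by simp
      ultimately show ?thesis by (simp add: mult.commute)
    qed
    ultimately show ?thesis by (simp add: m_def r_def)
  qed
  have \<mu>: "(\<mu> has_real_derivative (1 / (x + \<sigma>)\<^sup>2 - 1 / x\<^sup>2) / 2) (at x)" if "x > 0" for x
    unfolding \<mu>_def
    using that \<sigma>(2) by (auto intro!: derivative_eq_intros simp: power2_eq_square)
  have dA: "((\<lambda>x. e / x) has_real_derivative - (e / x\<^sup>2)) (at x)" if "x > 0" for x
    using that by (auto intro!: derivative_eq_intros simp: power2_eq_square)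
  have dB: "((\<lambda>x. 1 + \<sigma> / x) has_real_derivative - 2 * \<mu> x * (1 + \<sigma> / x)) (at x)" if "x > 0" for x
  proof -
    have "((\<lambda>x. 1 + \<sigma> / x) has_real_derivative - (\<sigma> / x\<^sup>2)) (at x)"
      using that by (auto intro!: derivative_eq_intros simp: power2_eq_square)
    moreover have "- (\<sigma> / x\<^sup>2) = - 2 * \<mu> x * (1 + \<sigma> / x)"
      using that \<sigma>(2) by (simp add: \<mu>_def divide_simps) algebra
    ultimately show ?thesis by simp
  qed
  have G: "(1 + \<sigma> / x) * (1 - \<sigma> / x) - (\<mu> x + e / x)\<^sup>2
      - (1 / (x + \<sigma>)\<^sup>2 - 1 / x\<^sup>2) / 2 - (- (e / x\<^sup>2)) = bessel_comb_potential b e \<sigma> x"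
    if "x > 0" for x
  proof -
    \<comment> \<open>After replacing \<open>b^2\<close> by \<open>\<sigma>^2 + e^2\<close> both
      sides are the same polynomial in \<open>p\<close> and \<open>q\<close>.\<close>
    define p q where "p = 1 / x" and "q = 1 / (x + \<sigma>)"
    have *: "r / x = r * p" "r / (x + \<sigma>) = r * q" "r / x\<^sup>2 = r * p\<^sup>2" "r / (x + \<sigma>)\<^sup>2 = r * q\<^sup>2"
      "r / (x * (x + \<sigma>)) = r * (p * q)" for r
      by (auto simp: p_def q_def power_divide)
    show ?thesis
      unfolding bessel_comb_potential_def \<mu>_def * bb[symmetric]
      by (simp add: field_simps power2_eq_square)
  qed
  show thesis
  proof
    fix x :: real assume x: "x > 0"
    note nf = first_order_system_normal_form[where A = "\<lambda>x. e / x" and B = "\<lambda>x. 1 + \<sigma> / x"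
        and D = "\<lambda>x. 1 - \<sigma> / x" and u = u and v = v and m = m and \<mu> = \<mu>,
        OF u[OF x] v[OF x] dA[OF x] dB[OF x] m[OF x] \<mu>[OF x]]
    show "(w has_real_derivative w' x) (at x)"
      using nf(1) by (simp add: w_def[abs_def] w'_def)
    show "(w' has_real_derivative - bessel_comb_potential b e \<sigma> x * w x) (at x)"
      using nf(2) unfolding G[OF x] by (simp add: w_def w'_def[abs_def])
    have "u x = sqrt x * (c * Bessel_J a x + d * Bessel_J (a + 1) x)"
      by (simp add: u_def y_def z_def algebra_simps)
    moreover have "m x \<noteq> 0"
      using x \<sigma>(2) by (simp add: m_def)
    ultimately show "w x = 0 \<longleftrightarrow> x \<in> bessel_pos_zeros a c d"
      using x by (simp add: w_def bessel_pos_zeros_def)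
  qed
qed

section \<open>Second differences of the transformed zeros\<close>

lemma consecutive_not_in:
  assumes "lists_increasingly j Z" "k \<ge> 1" "j k < x" "x < j (k + 1)"
  shows "x \<notin> Z"
proof
  assume "x \<in> Z"
  then obtain n where n: "n \<ge> 1" "x = j n"
    using assms(1) by (auto simp: lists_increasingly_def)
  have mono: "j p < j q" if "1 \<le> p" "p < q" for p q
    using assms(1) that by (auto simp: lists_increasingly_def strict_mono_on_def)
  have "n \<le> k \<or> n \<ge> k + 1" by linarith
  then show False
    using mono[of n k] mono[of "k + 1" n] assms n by (cases "n = k"; cases "n = k + 1") auto
qed

text \<open>The common interface of the four cases: each supplies a density \<open>\<rho>\<close>,
  an antiderivative \<open>t\<close>, the logarithmic derivative \<open>l\<close> of
  \<open>\<rho>\<close>, and a potential \<open>\<Phi>\<close> monotone between \<open>j k\<close>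
  and \<open>j (k + 2)\<close>. Comparing the two consecutive gaps in \<open>t\<close> is the sign
  of a second difference.\<close>

lemma bessel_zeros_second_difference:
  fixes a b c d e \<sigma> :: real and j :: "nat \<Rightarrow> real" and \<rho> l l' t \<Phi> :: "real \<Rightarrow> real"
  assumes a: "a > -1" and nz: "c \<noteq> 0" "d \<noteq> 0"
    and j: "lists_increasingly j (bessel_pos_zeros a c d)" and k: "k \<ge> 1"
    and b: "b = a + 1/2" and \<sigma>: "\<sigma> = (2 * a + 1) * c * d / (c\<^sup>2 + d\<^sup>2)" "\<sigma> > 0"
    and e: "e = b * (c\<^sup>2 - d\<^sup>2) / (c\<^sup>2 + d\<^sup>2)"
    and \<rho>: "\<And>x. x > 0 \<Longrightarrow> \<rho> x > 0"
    and t: "\<And>x. x > 0 \<Longrightarrow> (t has_real_derivative \<rho> x) (at x)"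
    and d\<rho>: "\<And>x. x > 0 \<Longrightarrow> (\<rho> has_real_derivative l x * \<rho> x) (at x)"
    and l: "\<And>x. x > 0 \<Longrightarrow> (l has_real_derivative l' x) (at x)"
    and \<Phi>: "\<And>x. x > 0 \<Longrightarrow>
      \<Phi> x * (\<rho> x)\<^sup>2 = bessel_comb_potential b e \<sigma> x + (l x)\<^sup>2 / 4 - l' x / 2"
  shows "(\<And>x y. j k \<le> x \<Longrightarrow> x < y \<Longrightarrow> y \<le> j (k + 2) \<Longrightarrow> \<Phi> x < \<Phi> y) \<Longrightarrow>
      diff2 (\<lambda>i. t (j i)) k < 0"
    and "(\<And>x y. j k \<le> x \<Longrightarrow> x < y \<Longrightarrow> y \<le> j (k + 2) \<Longrightarrow> \<Phi> y < \<Phi> x) \<Longrightarrow>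
      diff2 (\<lambda>i. t (j i)) k > 0"
proof -
  obtain w w' where w: "\<And>x. x > 0 \<Longrightarrow> (w has_real_derivative w' x) (at x)"
    "\<And>x. x > 0 \<Longrightarrow> (w' has_real_derivative - bessel_comb_potential b e \<sigma> x * w x) (at x)"
    and wz: "\<And>x. x > 0 \<Longrightarrow> w x = 0 \<longleftrightarrow> x \<in> bessel_pos_zeros a c d"
    by (rule bessel_comb_normal_form[OF a nz b \<sigma> e]) (rule that)
  have jz: "j i \<in> bessel_pos_zeros a c d" if "i \<ge> 1" for i
    using j that by (auto simp: lists_increasingly_def)
  then have pos: "j i > 0" if "i \<ge> 1" for i
    using that by (auto simp: bessel_pos_zeros_def)
  have ord: "0 < j k" "j k < j (k + 1)" "j (k + 1) < j (k + 2)"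
    using j k pos by (auto simp: lists_increasingly_def strict_mono_on_def)
  have zero: "w (j k) = 0" "w (j (k + 1)) = 0" "w (j (k + 2)) = 0"
    using wz jz pos k by auto
  have nonz: "w x \<noteq> 0" if "x \<in> {j k<..<j (k + 1)} \<union> {j (k + 1)<..<j (k + 2)}" for x
    using that wz[of x] ord k consecutive_not_in[OF j, of k x] consecutive_not_in[OF j, of "k + 1" x]
    by auto
  note gaps = normal_form_gaps[OF ord w zero nonz \<rho> t d\<rho> l \<Phi>]
  show "diff2 (\<lambda>i. t (j i)) k < 0"
    if "\<And>x y. j k \<le> x \<Longrightarrow> x < y \<Longrightarrow> y \<le> j (k + 2) \<Longrightarrow> \<Phi> x < \<Phi> y"
    using gaps(1)[OF _ _ _ _ _ _ _ _ that] by (simp add: diff2_def)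
  show "diff2 (\<lambda>i. t (j i)) k > 0"
    if "\<And>x y. j k \<le> x \<Longrightarrow> x < y \<Longrightarrow> y \<le> j (k + 2) \<Longrightarrow> \<Phi> y < \<Phi> x"
    using gaps(2)[OF _ _ _ _ _ _ _ _ that] by (simp add: diff2_def)
qed

section \<open>The four densities\<close>

text \<open>The derivative is a cubic form in \<open>p = 1/z\<close> and
  \<open>q = 1/(z + \<sigma>)\<close>, smallest for \<open>e = b\<close>. In that case it is
  \<open>(b + 1/2) (p - q)^2 (p + q)\<close>, which is positive, plus
  \<open>(b - 1) ((2 b + 1) p^3 - q^3)\<close>, which is nonnegative since \<open>b \<ge> 1\<close>
  and \<open>q < p\<close>.\<close>

lemma bessel_comb_potential_mono:
  fixes b e \<sigma> :: real
  assumes "b \<ge> 1" "e \<le> b" "\<sigma> > 0" "0 < x" "x < y"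
  shows "bessel_comb_potential b e \<sigma> x < bessel_comb_potential b e \<sigma> y"
proof (rule DERIV_pos_imp_increasing[OF \<open>x < y\<close>])
  fix z assume "x \<le> z"
  then have z: "z > 0" using assms by auto
  define p q where "p = 1 / z" and "q = 1 / (z + \<sigma>)"
  have pq: "0 < q" "q < p"
    using z assms by (auto simp: p_def q_def field_simps)
  define D where "D = 2 * (b\<^sup>2 - 1/4) * p^3 - (e + 1/2) * (p\<^sup>2 * q + p * q\<^sup>2) + 3/2 * q^3"
  have "(bessel_comb_potential b e \<sigma> has_real_derivative D) (at z)"
  proof -
    define P Q :: "real \<Rightarrow> real" where "P = (\<lambda>x. 1 / x)" and "Q = (\<lambda>x. 1 / (x + \<sigma>))"
    have *: "bessel_comb_potential b e \<sigma> = (\<lambda>x. 1 - (b\<^sup>2 - 1/4) * (P x)\<^sup>2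
        + (e + 1/2) * (P x * Q x) - 3/4 * (Q x)\<^sup>2)"
      by (simp add: bessel_comb_potential_def fun_eq_iff power_divide P_def Q_def)
    have PQ: "P z = p" "Q z = q" by (simp_all add: P_def Q_def p_def q_def)
    have dP: "(P has_real_derivative - p\<^sup>2) (at z)" and dQ: "(Q has_real_derivative - q\<^sup>2) (at z)"
      unfolding P_def Q_def p_def q_def using z assms
      by (auto intro!: derivative_eq_intros simp: power2_eq_square)
    show ?thesis
      unfolding *
      by (rule derivative_eq_intros dP dQ refl)+
        (simp add: D_def PQ power2_eq_square power3_eq_cube algebra_simps)
  qed
  moreover have "D > 0"
  proof -
    have "(b + 1/2) * (p\<^sup>2 * q + p * q\<^sup>2) \<ge> (e + 1/2) * (p\<^sup>2 * q + p * q\<^sup>2)"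
      using assms pq by (intro mult_right_mono) auto
    moreover have "2 * (b\<^sup>2 - 1/4) * p^3 - (b + 1/2) * (p\<^sup>2 * q + p * q\<^sup>2) + 3/2 * q^3
        = (b + 1/2) * ((p - q)\<^sup>2 * (p + q)) + (b - 1) * ((2 * b + 1) * p^3 - q^3)"
      by (simp add: power2_eq_square power3_eq_cube field_simps)
    moreover have "(b + 1/2) * ((p - q)\<^sup>2 * (p + q)) > 0"
      using assms pq by auto
    moreover have "(b - 1) * ((2 * b + 1) * p^3 - q^3) \<ge> 0"
    proof -
      have "q^3 \<le> 1 * p^3" using pq by (auto intro: power_mono)
      also have "\<dots> \<le> (2 * b + 1) * p^3" using assms pq by (intro mult_right_mono) auto
      finally show ?thesis using assms by auto
    qed
    ultimately show ?thesis unfolding D_def by linarith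
  qed
  ultimately show "\<exists>D. (bessel_comb_potential b e \<sigma> has_real_derivative D) (at z) \<and> D > 0"
    by blast
qed

context
  fixes a b c d e \<sigma> :: real and j :: "nat \<Rightarrow> real" and k :: nat
  assumes a: "a > -1" and nz: "c \<noteq> 0" "d \<noteq> 0"
    and j: "lists_increasingly j (bessel_pos_zeros a c d)" and k: "k \<ge> 1"
    and b: "b = a + 1/2" and \<sigma>: "\<sigma> = (2 * a + 1) * c * d / (c\<^sup>2 + d\<^sup>2)" "\<sigma> > 0"
    and e: "e = b * (c\<^sup>2 - d\<^sup>2) / (c\<^sup>2 + d\<^sup>2)"
begin

private lemma sum_pos: "c\<^sup>2 + d\<^sup>2 > 0"
  using nz by (simp add: sum_power2_gt_zero_iff)

private lemmas sq_sum = rotation_coeffs_pythagoras[OF nz b \<sigma>(1) e]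

private lemma abs_e: "\<bar>e\<bar> < \<bar>b\<bar>"
proof -
  have "e\<^sup>2 < b\<^sup>2" using sq_sum \<sigma>(2) by (smt (verit) zero_less_power)
  then show ?thesis by (rule_tac power2_less_imp_less) auto
qed

private lemma zero_in: "i \<ge> 1 \<Longrightarrow> j i \<in> bessel_pos_zeros a c d"
  using j by (auto simp: lists_increasingly_def)

private lemma zero_pos: "i \<ge> 1 \<Longrightarrow> j i > 0"
  using zero_in by (auto simp: bessel_pos_zeros_def)

private lemmas second_difference = bessel_zeros_second_difference[OF a nz j k b \<sigma> e]

text \<open>The density is \<open>1\<close> and \<open>t\<close> is \<open>id\<close>, so
  \<open>\<Phi>\<close> is the original potential; \<open>a \<ge> 1/2\<close> means
  \<open>b \<ge> 1\<close>, where that potential increases.\<close>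

lemma gaps_decrease:
  assumes "a \<ge> 1/2"
  shows "diff2 j k < 0"
proof -
  have "diff2 (\<lambda>i. id (j i)) k < 0"
  proof (rule second_difference(1)[where \<rho> = "\<lambda>_. 1" and l = "\<lambda>_. 0" and l' = "\<lambda>_. 0"])
    show "bessel_comb_potential b e \<sigma> x < bessel_comb_potential b e \<sigma> y"
      if "j k \<le> x" "x < y" for x y
      using that assms b \<sigma> abs_e zero_pos[OF k]
      by (intro bessel_comb_potential_mono) auto
  qed (auto intro!: derivative_eq_intros)
  then show ?thesis by simp
qed

lemma log_recip_second_difference_neg:
  assumes "-1/2 < a" "a \<le> 0"
  shows "diff2 (\<lambda>i. ln (1 + \<sigma> / j i) - \<sigma> / j i) k < 0"
proof -
  define t where "t x = (ln (1 + \<sigma> / x) - \<sigma> / x) / \<sigma>\<^sup>2" for x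
  \<comment> \<open>Expanded in this way, every summand is nondecreasing on the positive half-line:
    \<open>0 < b \<le> 1/2\<close> and \<open>\<bar>e\<bar> < b\<close> make
    \<open>1/4 - b^2\<close>, \<open>e + 3/2\<close> and \<open>3/4 - b^2 + e\<close> nonnegative.
    The first summand is strictly increasing.\<close>
  define \<Phi> where "\<Phi> x = x^4 * (x + \<sigma>)\<^sup>2 + (1/4 - b\<^sup>2) * (2 * \<sigma> * x^3 + \<sigma>\<^sup>2 * x\<^sup>2)
    + (e + 3/2) * \<sigma> * x^3 + (3/4 - b\<^sup>2 + e) * x^4" for x
  have b01: "0 < b" "b \<le> 1/2" using assms b by auto
  have bb: "b\<^sup>2 \<le> 1/4" using power_mono[OF b01(2), of 2] b01 by (simp add: power2_eq_square)
  have "diff2 (\<lambda>i. t (j i)) k < 0"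
  proof (rule second_difference(1)[where \<rho> = "\<lambda>x. 1 / (x\<^sup>2 * (x + \<sigma>))" and \<Phi> = \<Phi>
        and l = "\<lambda>x. - 2 / x - 1 / (x + \<sigma>)" and l' = "\<lambda>x. 2 / x\<^sup>2 + 1 / (x + \<sigma>)\<^sup>2"])
    fix x :: real assume x: "x > 0"
    then have xs: "x + \<sigma> > 0" using \<sigma>(2) by simp
    show "1 / (x\<^sup>2 * (x + \<sigma>)) > 0" using x xs by simp
    show "(t has_real_derivative 1 / (x\<^sup>2 * (x + \<sigma>))) (at x)"
      unfolding t_def
      by (rule derivative_eq_intros refl | (use x xs \<sigma>(2) in \<open>simp add: add_pos_pos; fail\<close>))+
        (use x xs \<sigma>(2) in \<open>simp add: divide_simps add_pos_pos, algebra?\<close>)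
    show "((\<lambda>x. 1 / (x\<^sup>2 * (x + \<sigma>))) has_real_derivative
        (- 2 / x - 1 / (x + \<sigma>)) * (1 / (x\<^sup>2 * (x + \<sigma>)))) (at x)"
      by (rule derivative_eq_intros refl | (use x xs in \<open>simp; fail\<close>))+
        (use x xs in \<open>simp add: divide_simps, algebra?\<close>)
    show "((\<lambda>x. - 2 / x - 1 / (x + \<sigma>)) has_real_derivative 2 / x\<^sup>2 + 1 / (x + \<sigma>)\<^sup>2) (at x)"
      by (rule derivative_eq_intros refl | (use x xs in \<open>simp; fail\<close>))+
        (use x xs in \<open>simp add: power2_eq_square\<close>)
    show "\<Phi> x * (1 / (x\<^sup>2 * (x + \<sigma>)))\<^sup>2 = bessel_comb_potential b e \<sigma> x
        + (- 2 / x - 1 / (x + \<sigma>))\<^sup>2 / 4 - (2 / x\<^sup>2 + 1 / (x + \<sigma>)\<^sup>2) / 2"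
    proof -
      define s where "s = x + \<sigma>"
      have s: "s > 0" using xs by (simp add: s_def)
      define p q where "p = 1 / x" and "q = 1 / s"
      have *: "r / x = r * p" "r / s = r * q" "r / x\<^sup>2 = r * p\<^sup>2" "r / s\<^sup>2 = r * q\<^sup>2"
        "r / (x * s) = r * (p * q)" for r
        by (auto simp: p_def q_def power_divide)
      have "\<Phi> x = x^4 * s\<^sup>2 + (1/4 - b\<^sup>2) * (x\<^sup>2 * s\<^sup>2) + (e + 3/2) * (x^3 * s) - x^4"
        by (simp add: \<Phi>_def s_def algebra_simps eval_nat_numeral)
      also have "\<dots> * (1 / (x\<^sup>2 * s))\<^sup>2 = 1 + (1/4 - b\<^sup>2) * p\<^sup>2 + (e + 3/2) * (p * q) - q\<^sup>2"
      proof -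
        have "x^4 * s\<^sup>2 * (1 / (x\<^sup>2 * s))\<^sup>2 = 1" "x\<^sup>2 * s\<^sup>2 * (1 / (x\<^sup>2 * s))\<^sup>2 = p\<^sup>2"
          "x^3 * s * (1 / (x\<^sup>2 * s))\<^sup>2 = p * q" "x^4 * (1 / (x\<^sup>2 * s))\<^sup>2 = q\<^sup>2"
          using x s by (simp_all add: p_def q_def field_simps eval_nat_numeral)
        then show ?thesis
          by (simp only: left_diff_distrib distrib_right mult.assoc)
      qed
      finally have eq: "\<Phi> x * (1 / (x\<^sup>2 * s))\<^sup>2 = \<dots>" .
      show ?thesis
        unfolding bessel_comb_potential_def s_def[symmetric] eq unfolding *
        by (simp add: power2_eq_square field_simps)
    qed
  next
    fix x y assume "j k \<le> x" "x < y"
    then have xy: "0 < x" "x < y" using zero_pos[OF k] by auto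
    have pw: "x ^ n \<le> y ^ n" for n using xy by (intro power_mono) auto
    have "x^4 * (x + \<sigma>)\<^sup>2 < y^4 * (y + \<sigma>)\<^sup>2"
      using xy \<sigma>(2) by (intro mult_strict_mono power_strict_mono) auto
    moreover have "(1/4 - b\<^sup>2) * (2 * \<sigma> * x^3 + \<sigma>\<^sup>2 * x\<^sup>2) \<le> (1/4 - b\<^sup>2) * (2 * \<sigma> * y^3 + \<sigma>\<^sup>2 * y\<^sup>2)"
      using bb \<sigma>(2) pw by (intro mult_left_mono add_mono) auto
    moreover have "(e + 3/2) * \<sigma> * x^3 \<le> (e + 3/2) * \<sigma> * y^3"
      using abs_e b01 \<sigma>(2) pw by (intro mult_left_mono) auto
    moreover have "(3/4 - b\<^sup>2 + e) * x^4 \<le> (3/4 - b\<^sup>2 + e) * y^4"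
      using abs_e b01 bb pw by (intro mult_left_mono) auto
    ultimately show "\<Phi> x < \<Phi> y"
      unfolding \<Phi>_def by linarith
  qed
  moreover have "diff2 (\<lambda>i. t (j i)) k = diff2 (\<lambda>i. ln (1 + \<sigma> / j i) - \<sigma> / j i) k / \<sigma>\<^sup>2"
    by (simp add: diff2_def t_def diff_divide_distrib add_divide_distrib)
  ultimately show ?thesis
    using \<sigma>(2) by (simp add: divide_less_0_iff)
qed

text \<open>For \<open>0 < x \<le> 2\<close> one has \<open>(x/2)^2 \<le> 1 < a + 1\<close>, so both
  Bessel functions are positive; \<open>\<sigma> > 0\<close> and \<open>a > 0\<close> force
  \<open>c\<close> and \<open>d\<close> to have the same sign, so the combination cannot
  vanish.\<close>

lemma zero_gt_2:
  assumes "a > 0"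
  shows "j k > 2"
proof (rule ccontr)
  assume "\<not> j k > 2"
  then have "(j k / 2)\<^sup>2 \<le> 1\<^sup>2"
    using zero_pos[OF k] by (intro power_mono) auto
  then have J: "Bessel_J a (j k) > 0" "Bessel_J (a + 1) (j k) > 0"
    using assms zero_pos[OF k] by (auto intro!: Bessel_J_pos)
  have "c * d > 0"
    using \<sigma> sum_pos assms by (simp add: zero_less_divide_iff zero_less_mult_iff mult.assoc)
  then have "c * Bessel_J a (j k) + d * Bessel_J (a + 1) (j k) \<noteq> 0"
    using J by (smt (verit) mult_pos_pos mult_neg_pos zero_less_mult_iff)
  then show False
    using zero_in[OF k] by (simp add: bessel_pos_zeros_def)
qed

lemma log_recip_sq_second_difference_pos:
  assumes "0 < a" "a < 1/2"
  shows "diff2 (\<lambda>i. ln (1 + \<sigma> / j i) - \<sigma> / j i + \<sigma>\<^sup>2 / (j i)\<^sup>2) k > 0"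
proof -
  \<comment> \<open>The minus sign makes \<open>t\<close> increasing, since the bracket has
    derivative \<open>- \<sigma>^2 (x + 2 \<sigma>) / (x^3 (x + \<sigma>))\<close>. It also turns
    the negative second difference of \<open>t\<close> into the positive one claimed.\<close>
  define t where "t x = - ((ln (1 + \<sigma> / x) - \<sigma> / x + \<sigma>\<^sup>2 / x\<^sup>2) / \<sigma>\<^sup>2)" for x
  define g h where "g x = x / (x + \<sigma>)" and "h x = x / (x + 2 * \<sigma>)" for x
  \<comment> \<open>\<open>M\<close> is \<open>x^2\<close> times the transformed potential
    \<open>G + l^2/4 - l'/2\<close>, written with the bounded ratios \<open>g\<close> and
    \<open>h\<close> so that \<open>x^2\<close> visibly dominates.\<close>
  define M where "M x = x\<^sup>2 + (1 - b\<^sup>2) + (e + 2) * g x - (g x)\<^sup>2 + 3/4 * (h x)\<^sup>2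
    - 3/2 * h x - 1/2 * (g x * h x)" for x
  define \<Phi> where "\<Phi> x = ((x + \<sigma>) / (x + 2 * \<sigma>))\<^sup>2 * x^4 * M x" for x
  have b01: "1/2 < b" "b < 1" using assms b by auto
  have bb: "b\<^sup>2 \<le> 1" using b01 power_mono[of b 1 2] by simp
  have e2: "e + 2 > 1" using abs_e b01 by auto
  have gh: "0 < g x" "g x \<le> 1" "0 < h x" "h x \<le> 1" if "x > 0" for x
    using that \<sigma>(2) by (auto simp: g_def h_def)
  \<comment> \<open>The increment is \<open>s / (x + s) * (1 / (y + s)) * (y - x)\<close>; the first
    factor is at most \<open>1\<close> and, because \<open>y > 2\<close>, the second is at most
    \<open>1/2\<close>.\<close>
  have step: "x / (x + s) < y / (y + s)" "y / (y + s) - x / (x + s) \<le> (y - x) / 2"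
    if "2 \<le> x" "x < y" "s > 0" for x y s :: real
  proof -
    have eq: "y / (y + s) - x / (x + s) = s / (x + s) * (1 / (y + s)) * (y - x)"
      using that by (simp add: divide_simps) algebra
    have "s / (x + s) * (1 / (y + s)) \<le> 1 * (1 / 2)"
      using that by (intro mult_mono) (auto simp: divide_simps)
    then have "s / (x + s) * (1 / (y + s)) * (y - x) \<le> 1 * (1 / 2) * (y - x)"
      using that by (intro mult_right_mono) auto
    then show "y / (y + s) - x / (x + s) \<le> (y - x) / 2"
      unfolding eq by simp
    have "s / (x + s) * (1 / (y + s)) * (y - x) > 0"
      using that by simp
    then show "x / (x + s) < y / (y + s)"
      using eq by linarith
  qed
  \<comment> \<open>At worst the sum is \<open>4 - 1 - 3/2 - 1/2 = 1\<close>, the remaining terms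
    being nonnegative.\<close>
  have M_pos: "M x > 0" if "2 \<le> x" for x
  proof -
    have "h x \<le> 1" using gh(4)[of x] that by simp
    moreover have "x\<^sup>2 \<ge> 4" using that power_mono[of 2 x 2] by simp
    moreover have "(g x)\<^sup>2 \<le> 1" "g x * h x \<le> 1" "(e + 2) * g x > 0" "(h x)\<^sup>2 \<ge> 0"
      using gh[of x] that e2 by (auto simp: power_le_one mult_le_one)
    ultimately show ?thesis
      unfolding M_def using bb by linarith
  qed
  \<comment> \<open>Put \<open>D = y - x\<close>. The term \<open>x^2\<close> gains at least
    \<open>4 D\<close>, whereas the three subtracted terms lose at most \<open>D\<close>,
    \<open>3/4 D\<close> and \<open>1/2 D\<close>.\<close>
  have M_mono: "M x < M y" if "2 \<le> x" "x < y" for x y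
  proof -
    have pos: "0 < x" "0 < y" using that by auto
    have dg: "g x < g y" "g y - g x \<le> (y - x) / 2" and dh: "h x < h y" "h y - h x \<le> (y - x) / 2"
      using step[OF that, of \<sigma>] step[OF that, of "2 * \<sigma>"] \<sigma>(2) by (auto simp: g_def h_def)
    have "y\<^sup>2 - x\<^sup>2 = (y + x) * (y - x)" by algebra
    also have "\<dots> \<ge> 4 * (y - x)" using that by (intro mult_right_mono) auto
    finally have "y\<^sup>2 - x\<^sup>2 \<ge> 4 * (y - x)" .
    moreover have "(e + 2) * g x \<le> (e + 2) * g y"
      using e2 dg by (intro mult_left_mono) auto
    moreover have "(h x)\<^sup>2 \<le> (h y)\<^sup>2"
      using dh(1) gh(3)[OF pos(1)] by (intro power_mono) auto
    moreover have "(g y)\<^sup>2 - (g x)\<^sup>2 \<le> 2 * ((y - x) / 2)"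
    proof -
      have "(g y)\<^sup>2 - (g x)\<^sup>2 = (g y + g x) * (g y - g x)" by algebra
      also have "\<dots> \<le> 2 * ((y - x) / 2)"
        using dg gh[OF pos(1)] gh[OF pos(2)] by (intro mult_mono) auto
      finally show ?thesis .
    qed
    moreover have "g y * h y - g x * h x \<le> y - x"
    proof -
      have "g y * h y - g x * h x = g y * (h y - h x) + (g y - g x) * h x" by algebra
      also have "\<dots> \<le> 1 * ((y - x) / 2) + (y - x) / 2 * 1"
        using dg dh gh[OF pos(1)] gh[OF pos(2)] by (intro add_mono mult_mono) auto
      finally show ?thesis by simp
    qed
    moreover have "X + B + E - G + 3/4 * H - 3/2 * K - 1/2 * L
        < X' + B + E' - G' + 3/4 * H' - 3/2 * K' - 1/2 * L'"
      if "X' - X \<ge> 4 * D" "E \<le> E'" "H \<le> H'" "G' - G \<le> 2 * (D / 2)" "L' - L \<le> D"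
        "K' - K \<le> D / 2" "D > 0" for X X' B E E' G G' H H' K K' L L' D :: real
      using that by linarith
    ultimately show ?thesis
      unfolding M_def using dh(2) \<open>x < y\<close> by (metis diff_gt_0_iff_gt)
  qed
  have "diff2 (\<lambda>i. t (j i)) k < 0"
  proof (rule second_difference(1)[where \<rho> = "\<lambda>x. (x + 2 * \<sigma>) / (x^3 * (x + \<sigma>))" and \<Phi> = \<Phi>
        and l = "\<lambda>x. 1 / (x + 2 * \<sigma>) - 3 / x - 1 / (x + \<sigma>)"
        and l' = "\<lambda>x. - 1 / (x + 2 * \<sigma>)\<^sup>2 + 3 / x\<^sup>2 + 1 / (x + \<sigma>)\<^sup>2"])
    fix x :: real assume x: "x > 0"
    then have xs: "x + \<sigma> > 0" "x + 2 * \<sigma> > 0" using \<sigma>(2) by auto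
    show "(x + 2 * \<sigma>) / (x^3 * (x + \<sigma>)) > 0" using x xs by simp
    show "(t has_real_derivative (x + 2 * \<sigma>) / (x^3 * (x + \<sigma>))) (at x)"
      unfolding t_def
      by (rule derivative_eq_intros refl | (use x xs \<sigma>(2) in \<open>simp add: add_pos_pos; fail\<close>))+
        (use x xs \<sigma>(2) in \<open>simp add: divide_simps add_pos_pos, algebra?\<close>)
    show "((\<lambda>x. (x + 2 * \<sigma>) / (x^3 * (x + \<sigma>))) has_real_derivative
        (1 / (x + 2 * \<sigma>) - 3 / x - 1 / (x + \<sigma>)) * ((x + 2 * \<sigma>) / (x^3 * (x + \<sigma>)))) (at x)"
      by (rule derivative_eq_intros refl | (use x xs in \<open>simp; fail\<close>))+
        (use x xs in \<open>simp add: divide_simps, algebra?\<close>)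
    show "((\<lambda>x. 1 / (x + 2 * \<sigma>) - 3 / x - 1 / (x + \<sigma>)) has_real_derivative
        - 1 / (x + 2 * \<sigma>)\<^sup>2 + 3 / x\<^sup>2 + 1 / (x + \<sigma>)\<^sup>2) (at x)"
      by (rule derivative_eq_intros refl | (use x xs in \<open>simp; fail\<close>))+
        (use x xs in \<open>simp add: power2_eq_square\<close>)
    define p q r where "p = 1 / x" and "q = 1 / (x + \<sigma>)" and "r = 1 / (x + 2 * \<sigma>)"
    have *: "s / x = s * p" "s / (x + \<sigma>) = s * q" "s / x\<^sup>2 = s * p\<^sup>2" "s / (x + \<sigma>)\<^sup>2 = s * q\<^sup>2"
      "s / (x * (x + \<sigma>)) = s * (p * q)" "s / (x + 2 * \<sigma>) = s * r" "s / (x + 2 * \<sigma>)\<^sup>2 = s * r\<^sup>2" for s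
      by (auto simp: p_def q_def r_def power_divide)
    \<comment> \<open>Since \<open>g x = x q\<close> and \<open>h x = x r\<close>, the relation
      \<open>x p = 1\<close> turns \<open>M x * p^2\<close> into a polynomial in \<open>p\<close>,
      \<open>q\<close>, \<open>r\<close>.\<close>
    have xp: "x * p = 1" using x by (simp add: p_def)
    have "\<Phi> x * ((x + 2 * \<sigma>) / (x^3 * (x + \<sigma>)))\<^sup>2 = M x * p\<^sup>2"
    proof -
      have "(u / v)\<^sup>2 * x^4 * (v / (x^3 * u))\<^sup>2 = p\<^sup>2" if "u > 0" "v > 0" for u v
        using x that by (simp add: p_def field_simps eval_nat_numeral)
      from this[OF xs]
      show ?thesis by (simp add: \<Phi>_def mult_ac)
    qed
    also have "\<dots> = bessel_comb_potential b e \<sigma> x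
        + (1 / (x + 2 * \<sigma>) - 3 / x - 1 / (x + \<sigma>))\<^sup>2 / 4
        - (- 1 / (x + 2 * \<sigma>)\<^sup>2 + 3 / x\<^sup>2 + 1 / (x + \<sigma>)\<^sup>2) / 2"
      unfolding bessel_comb_potential_def M_def g_def h_def * using xp by algebra
    finally show "\<Phi> x * ((x + 2 * \<sigma>) / (x^3 * (x + \<sigma>)))\<^sup>2 = \<dots>" .
  next
    fix x y assume "j k \<le> x" and xy: "x < y"
    then have x: "2 \<le> x" using zero_gt_2[OF assms(1)] by auto
    have "(x + \<sigma>) / (x + 2 * \<sigma>) \<le> (y + \<sigma>) / (y + 2 * \<sigma>)"
      using x xy \<sigma>(2) by (simp add: divide_simps) (simp add: algebra_simps)
    then have "((x + \<sigma>) / (x + 2 * \<sigma>))\<^sup>2 * x^4 \<le> ((y + \<sigma>) / (y + 2 * \<sigma>))\<^sup>2 * y^4"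
      using x xy \<sigma>(2) by (intro mult_mono power_mono) auto
    moreover have "((x + \<sigma>) / (x + 2 * \<sigma>))\<^sup>2 * x^4 > 0"
      using x \<sigma>(2) by (intro mult_pos_pos zero_less_power divide_pos_pos) auto
    ultimately show "\<Phi> x < \<Phi> y"
      unfolding \<Phi>_def using M_mono[OF x xy] M_pos[OF x]
      by (intro mult_le_less_imp_less) auto
  qed
  moreover have "diff2 (\<lambda>i. t (j i)) k
      = - (diff2 (\<lambda>i. ln (1 + \<sigma> / j i) - \<sigma> / j i + \<sigma>\<^sup>2 / (j i)\<^sup>2) k / \<sigma>\<^sup>2)"
    by (simp add: diff2_def t_def diff_divide_distrib add_divide_distrib)
  ultimately show ?thesis
    using \<sigma>(2) by (simp add: zero_less_divide_iff)
qed

lemma linear_log_second_difference_pos: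
  assumes "a < -1/2" "d\<^sup>2 \<ge> c\<^sup>2"
  shows "diff2 (\<lambda>i. j i - \<sigma> * ln (\<sigma> + j i)) k > 0"
proof -
  \<comment> \<open>In powers of \<open>1/x\<close> all coefficients are nonnegative:
    \<open>e \<ge> 0\<close> because \<open>b < 0\<close> and \<open>c^2 \<le> d^2\<close>, while
    \<open>e \<le> 1\<close> and \<open>b^2 \<le> 1\<close>. The coefficient
    \<open>e (1 - e)\<close> arises from \<open>\<sigma>^2 - b^2 + e\<close>. The term
    \<open>2 \<sigma> / x\<close> makes the decrease strict.\<close>
  define \<Phi> where "\<Phi> x = 1 + 2 * \<sigma> * (1 / x) + e * (1 - e) * (1 / x)\<^sup>2
    + \<sigma> * (2 * (1 - b\<^sup>2) + e) * (1 / x)^3 + (1 - b\<^sup>2) * \<sigma>\<^sup>2 * (1 / x)^4" for x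
  have b01: "- 1/2 < b" "b < 0" using assms a b by auto
  have bb: "b\<^sup>2 \<le> 1" using power_mono[of "\<bar>b\<bar>" 1 2] b01 by simp
  have "e \<ge> 0"
    using b01 assms sum_pos by (auto simp: e zero_le_divide_iff mult_nonpos_nonpos)
  then have e01: "0 \<le> e" "e \<le> 1"
    using abs_e b01 by auto
  have "diff2 (\<lambda>i. (\<lambda>x. x - \<sigma> * ln (\<sigma> + x)) (j i)) k > 0"
  proof (rule second_difference(2)[where \<rho> = "\<lambda>x. x / (x + \<sigma>)" and \<Phi> = \<Phi>
        and l = "\<lambda>x. 1 / x - 1 / (x + \<sigma>)" and l' = "\<lambda>x. - 1 / x\<^sup>2 + 1 / (x + \<sigma>)\<^sup>2"])
    fix x :: real assume x: "x > 0"
    then have xs: "x + \<sigma> > 0" using \<sigma>(2) by simp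
    show "x / (x + \<sigma>) > 0" using x xs by simp
    show "((\<lambda>x. x - \<sigma> * ln (\<sigma> + x)) has_real_derivative x / (x + \<sigma>)) (at x)"
      by (rule derivative_eq_intros refl | (use x xs in \<open>simp; fail\<close>))+
        (use x xs in \<open>simp add: divide_simps, algebra?\<close>)
    show "((\<lambda>x. x / (x + \<sigma>)) has_real_derivative (1 / x - 1 / (x + \<sigma>)) * (x / (x + \<sigma>))) (at x)"
      by (rule derivative_eq_intros refl | (use x xs in \<open>simp; fail\<close>))+
        (use x xs in \<open>simp add: divide_simps, algebra?\<close>)
    show "((\<lambda>x. 1 / x - 1 / (x + \<sigma>)) has_real_derivative - 1 / x\<^sup>2 + 1 / (x + \<sigma>)\<^sup>2) (at x)"
      by (rule derivative_eq_intros refl | (use x xs in \<open>simp; fail\<close>))+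
        (use x xs in \<open>simp add: power2_eq_square\<close>)
    show "\<Phi> x * (x / (x + \<sigma>))\<^sup>2 = bessel_comb_potential b e \<sigma> x
        + (1 / x - 1 / (x + \<sigma>))\<^sup>2 / 4 - (- 1 / x\<^sup>2 + 1 / (x + \<sigma>)\<^sup>2) / 2"
    proof -
      define s where "s = x + \<sigma>"
      have s: "s > 0" using xs by (simp add: s_def)
      define p q where "p = 1 / x" and "q = 1 / s"
      have *: "r / x = r * p" "r / s = r * q" "r / x\<^sup>2 = r * p\<^sup>2" "r / s\<^sup>2 = r * q\<^sup>2"
        "r / (x * s) = r * (p * q)" for r
        by (auto simp: p_def q_def power_divide)
      have sp: "s * p = 1 + \<sigma> * p"
        using x by (simp add: s_def p_def field_simps)
      have "\<Phi> x = (s * p)\<^sup>2 + (1 - b\<^sup>2) * (p\<^sup>2 * (s * p)\<^sup>2) + e * (p\<^sup>2 * (s * p)) - p\<^sup>2"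
        unfolding \<Phi>_def p_def[symmetric] sp sq_sum[symmetric]
        by (simp add: algebra_simps eval_nat_numeral)
      also have "\<dots> * (x / s)\<^sup>2 = 1 + (1 - b\<^sup>2) * p\<^sup>2 + e * (p * q) - q\<^sup>2"
      proof -
        have "(s * p)\<^sup>2 * (x / s)\<^sup>2 = 1" "p\<^sup>2 * (s * p)\<^sup>2 * (x / s)\<^sup>2 = p\<^sup>2"
          "p\<^sup>2 * (s * p) * (x / s)\<^sup>2 = p * q" "p\<^sup>2 * (x / s)\<^sup>2 = q\<^sup>2"
          using x s by (simp_all add: p_def q_def field_simps eval_nat_numeral)
        then show ?thesis
          by (simp only: left_diff_distrib distrib_right mult.assoc)
      qed
      finally have eq: "\<Phi> x * (x / s)\<^sup>2 = \<dots>" .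
      show ?thesis
        unfolding bessel_comb_potential_def s_def[symmetric] eq unfolding *
        by (simp add: power2_eq_square field_simps)
    qed
  next
    fix x y assume "j k \<le> x" "x < y"
    then have xy: "0 < x" "x < y" using zero_pos[OF k] by auto
    then have lt: "1 / y < 1 / x" by (simp add: field_simps)
    have pw: "(1 / y) ^ n \<le> (1 / x) ^ n" for n using xy lt by (intro power_mono) auto
    have "2 * \<sigma> * (1 / y) < 2 * \<sigma> * (1 / x)"
      using lt \<sigma>(2) by (intro mult_strict_left_mono) auto
    moreover have "e * (1 - e) * (1 / y)\<^sup>2 \<le> e * (1 - e) * (1 / x)\<^sup>2"
      using e01 pw by (intro mult_left_mono) auto
    moreover have "\<sigma> * (2 * (1 - b\<^sup>2) + e) * (1 / y)^3 \<le> \<sigma> * (2 * (1 - b\<^sup>2) + e) * (1 / x)^3"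
      using e01 bb \<sigma>(2) pw by (intro mult_left_mono) auto
    moreover have "(1 - b\<^sup>2) * \<sigma>\<^sup>2 * (1 / y)^4 \<le> (1 - b\<^sup>2) * \<sigma>\<^sup>2 * (1 / x)^4"
      using bb pw by (intro mult_left_mono) auto
    ultimately show "\<Phi> y < \<Phi> x"
      unfolding \<Phi>_def by linarith
  qed
  then show ?thesis by simp
qed

end

section \<open>From second differences of logarithms to the stated products\<close>

lemma mult_div_square_eq_exp:
  fixes X Y Z :: real
  assumes "X > 0" "Y > 0" "Z > 0"
  shows "X * Y / Z\<^sup>2 = exp (ln X - 2 * ln Z + ln Y)"
proof -
  have "exp (2 * ln Z) = Z\<^sup>2"
    using assms by (simp add: exp_double)
  then show ?thesis
    using assms by (simp add: exp_add exp_diff)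
qed

theorem theorem1p3:
  fixes a c d \<sigma> :: real and j :: "nat \<Rightarrow> real"
  assumes "c \<noteq> 0" and "d \<noteq> 0" and "a > -1"
    and "lists_increasingly j (bessel_pos_zeros a c d)"
    and "\<sigma> = (2 * a + 1) * c * d / (c\<^sup>2 + d\<^sup>2)"
  shows "(a \<ge> 1/2 \<and> sgn c = sgn d \<longrightarrow>
           (\<forall>k\<ge>1. j (k + 2) - j (k + 1) < j (k + 1) - j k)) \<and>
         (0 < a \<and> a < 1/2 \<and> sgn c = sgn d \<longrightarrow>
           (\<forall>k\<ge>1. (1 + \<sigma> / j (k + 2)) * (1 + \<sigma> / j k) / (1 + \<sigma> / j (k + 1))\<^sup>2
              > exp (\<sigma> * recip_diff2 j k - \<sigma>\<^sup>2 * recip_sq_diff2 j k))) \<and>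
         (-1/2 < a \<and> a \<le> 0 \<and> sgn c = sgn d \<longrightarrow>
           (\<forall>k\<ge>1. (1 + \<sigma> / j (k + 2)) * (1 + \<sigma> / j k) / (1 + \<sigma> / j (k + 1))\<^sup>2
              < exp (\<sigma> * recip_diff2 j k))) \<and>
         (-1 < a \<and> a < -1/2 \<and> d\<^sup>2 \<ge> c\<^sup>2 \<and> sgn c = - sgn d \<longrightarrow>
           (\<forall>k\<ge>1. (\<sigma> + j (k + 2)) * (\<sigma> + j k) / (\<sigma> + j (k + 1))\<^sup>2
              < exp (1 / \<sigma> * diff2 j k)))"
proof -
  define b where "b = a + 1/2"
  define e where "e = b * (c\<^sup>2 - d\<^sup>2) / (c\<^sup>2 + d\<^sup>2)"
  note a = assms(3) and nz = assms(1,2) and j = assms(4)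
  have N: "c\<^sup>2 + d\<^sup>2 > 0"
    using nz by (simp add: sum_power2_gt_zero_iff)
  \<comment> \<open>In each case \<open>2 a + 1\<close> and \<open>c d\<close> have the same sign,
    both negative in the last one, so the standing condition \<open>\<sigma> > 0\<close> holds
    throughout.\<close>
  have \<sigma>_pos: "\<sigma> > 0" if "(2 * a + 1) * (c * d) > 0"
    using N that by (simp add: assms(5) mult.assoc)
  have same: "c * d > 0" if "sgn c = sgn d"
    using that nz by (auto simp: sgn_if zero_less_mult_iff split: if_splits)
  have opposite: "c * d < 0" if "sgn c = - sgn d"
    using that nz by (auto simp: sgn_if mult_less_0_iff split: if_splits)
  have jpos: "j i > 0" if "i \<ge> 1" for i
    using j that by (auto simp: lists_increasingly_def bessel_pos_zeros_def)
  show ?thesis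
  proof (intro conjI impI allI; elim conjE)
    fix k :: nat assume k: "k \<ge> 1" and h: "a \<ge> 1/2" "sgn c = sgn d"
    have "\<sigma> > 0" using h by (intro \<sigma>_pos mult_pos_pos[OF _ same]) auto
    from gaps_decrease[OF a nz j k b_def assms(5) this e_def h(1)]
    show "j (k + 2) - j (k + 1) < j (k + 1) - j k"
      by (simp add: diff2_def)
  next
    fix k :: nat assume k: "k \<ge> 1" and h: "0 < a" "a < 1/2" "sgn c = sgn d"
    have \<sigma>: "\<sigma> > 0" using h by (intro \<sigma>_pos mult_pos_pos[OF _ same]) auto
    have pos: "1 + \<sigma> / j i > 0" if "i \<ge> 1" for i
      using \<sigma> jpos[OF that] by (simp add: add_pos_pos)
    have "(1 + \<sigma> / j (k + 2)) * (1 + \<sigma> / j k) / (1 + \<sigma> / j (k + 1))\<^sup>2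
        = exp (diff2 (\<lambda>i. ln (1 + \<sigma> / j i)) k)"
      using k by (subst mult_div_square_eq_exp) (auto intro!: pos simp: diff2_def)
    \<comment> \<open>The rational corrections to the logarithm in \<open>t\<close> contribute
      exactly the exponent on the right-hand side.\<close>
    moreover have "diff2 (\<lambda>i. ln (1 + \<sigma> / j i) - \<sigma> / j i + \<sigma>\<^sup>2 / (j i)\<^sup>2) k
        = diff2 (\<lambda>i. ln (1 + \<sigma> / j i)) k - (\<sigma> * recip_diff2 j k - \<sigma>\<^sup>2 * recip_sq_diff2 j k)"
      by (simp add: diff2_def recip_diff2_def recip_sq_diff2_def algebra_simps)
    ultimately show "(1 + \<sigma> / j (k + 2)) * (1 + \<sigma> / j k) / (1 + \<sigma> / j (k + 1))\<^sup>2
        > exp (\<sigma> * recip_diff2 j k - \<sigma>\<^sup>2 * recip_sq_diff2 j k)"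
      using log_recip_sq_second_difference_pos[OF a nz j k b_def assms(5) \<sigma> e_def h(1,2)] by simp
  next
    fix k :: nat assume k: "k \<ge> 1" and h: "-1/2 < a" "a \<le> 0" "sgn c = sgn d"
    have \<sigma>: "\<sigma> > 0" using h by (intro \<sigma>_pos mult_pos_pos[OF _ same]) auto
    have pos: "1 + \<sigma> / j i > 0" if "i \<ge> 1" for i
      using \<sigma> jpos[OF that] by (simp add: add_pos_pos)
    have "(1 + \<sigma> / j (k + 2)) * (1 + \<sigma> / j k) / (1 + \<sigma> / j (k + 1))\<^sup>2
        = exp (diff2 (\<lambda>i. ln (1 + \<sigma> / j i)) k)"
      using k by (subst mult_div_square_eq_exp) (auto intro!: pos simp: diff2_def)
    moreover have "diff2 (\<lambda>i. ln (1 + \<sigma> / j i) - \<sigma> / j i) k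
        = diff2 (\<lambda>i. ln (1 + \<sigma> / j i)) k - \<sigma> * recip_diff2 j k"
      by (simp add: diff2_def recip_diff2_def algebra_simps)
    ultimately show "(1 + \<sigma> / j (k + 2)) * (1 + \<sigma> / j k) / (1 + \<sigma> / j (k + 1))\<^sup>2
        < exp (\<sigma> * recip_diff2 j k)"
      using log_recip_second_difference_neg[OF a nz j k b_def assms(5) \<sigma> e_def h(1,2)] by simp
  next
    fix k :: nat
    assume k: "k \<ge> 1" and h: "a < -1/2" "c\<^sup>2 \<le> d\<^sup>2" "sgn c = - sgn d"
    have \<sigma>: "\<sigma> > 0" using h by (intro \<sigma>_pos mult_neg_neg[OF _ opposite]) auto
    have pos: "\<sigma> + j i > 0" if "i \<ge> 1" for i
      using \<sigma> jpos[OF that] by simp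
    have "(\<sigma> + j (k + 2)) * (\<sigma> + j k) / (\<sigma> + j (k + 1))\<^sup>2
        = exp (diff2 (\<lambda>i. ln (\<sigma> + j i)) k)"
      using k by (subst mult_div_square_eq_exp) (auto intro!: pos simp: diff2_def)
    \<comment> \<open>Positivity of this expression, divided by \<open>\<sigma> > 0\<close>, bounds
      the second difference of the logarithms by \<open>diff2 j k / \<sigma>\<close>.\<close>
    moreover have "diff2 (\<lambda>i. j i - \<sigma> * ln (\<sigma> + j i)) k
        = diff2 j k - \<sigma> * diff2 (\<lambda>i. ln (\<sigma> + j i)) k"
      by (simp add: diff2_def algebra_simps)
    ultimately show "(\<sigma> + j (k + 2)) * (\<sigma> + j k) / (\<sigma> + j (k + 1))\<^sup>2
        < exp (1 / \<sigma> * diff2 j k)"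
      using linear_log_second_difference_pos[OF a nz j k b_def assms(5) \<sigma> e_def h(1,2)] \<sigma>
      by (simp add: field_simps)
  qed
qed

end
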